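(* Let $\mathcal{G}$ be a class of graphs with polynomial expansion. Let $\pi$ be a property of pairs $(G,Z)$ (with $G$ a graph and $Z\subseteq V(G)$ non-empty) of finite diameter, and let $\varepsilon>0$. Then there exists a positive integer $c$ such that for every graph $G\in\mathcal{G}$, every set returned by the $c$-local search for $\pi$-hitting sets on $G$ is a $\pi$-hitting set of size at most $(1+\varepsilon)\gamma_\pi(G)$.
   Context: All graphs are finite and simple. A graph $H$ is an $r$-shallow minor of $G$ if a graph isomorphic to $H$ is obtained from a subgraph of $G$ by contracting pairwise vertex-disjoint subgraphs, each of radius at most $r$. The density of $H$ is $|E(H)|/|V(H)|$. A graph $G$ has expansion bounded by $f:\mathbb{Z}_0^+\to\mathbb{R}_0^+$ if for every non-negative integer $r$, every $r$-shallow minor of $G$ has density at most $f(r)$; a class has polynomial expansion if all its graphs have expansion bounded by some fixed polynomial $f$. A property $\pi$ is a property of pairs $(G,Z)$ where $G$ is a graph and $Z\subseteq V(G)$ is non-empty. The diameter of $\pi$ is the maximum diameter of $G[Z]$ over all pairs $(G,Z)$ satisfying $\pi$, or $\infty$ if these diameters are unbounded (in particular if $G[Z]$ is disconnected for some such pair). A set $X\subseteq V(G)$ is a $\pi$-hitting set if $X$ intersects every $Z\subseteq V(G)$ such that $(G,Z)$ satisfies $\pi$; $\gamma_\pi(G)$ is the minimum size of a $\pi$-hitting set in $G$. The $c$-local search for $\pi$-hitting sets on $G$: (1) set $X=V(G)$; (2) iterate over all sets $Y\subseteq V(G)$ with $|Y|\le c$ and $|X\triangle Y|<|X|$ ($\triangle$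 = symmetric difference); if $X\triangle Y$ is a $\pi$-hitting set, replace $X$ by $X\triangle Y$ and restart step (2). When no such $Y$ exists, return $X$. *)

theory Defs
  imports "HOL-Computational_Algebra.Polynomial"
begin

type_synonym 'a graph = "'a set \<times> 'a set set"

definition verts :: "'a graph \<Rightarrow> 'a set" where "verts G = fst G"
definition edges :: "'a graph \<Rightarrow> 'a set set" where "edges G = snd G"

definition is_graph :: "'a graph \<Rightarrow> bool" where
  "is_graph G \<longleftrightarrow> finite (verts G) \<and>
     (\<forall>e\<in>edges G. \<exists>u v. e = {u, v} \<and> u \<noteq> v \<and> u \<in> verts G \<and> v \<in> verts G)"

definition walk_within :: "'a graph \<Rightarrow> 'a set \<Rightarrow> nat \<Rightarrow> 'a \<Rightarrow> 'a \<Rightarrow> bool" where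
  "walk_within G S k u v \<longleftrightarrow> (\<exists>ps. ps \<noteq> [] \<and> hd ps = u \<and> last ps = v \<and>
      length ps \<le> k + 1 \<and> set ps \<subseteq> S \<and>
      (\<forall>i. i + 1 < length ps \<longrightarrow> {ps ! i, ps ! (i + 1)} \<in> edges G))"

definition radius_le :: "'a graph \<Rightarrow> 'a set \<Rightarrow> nat \<Rightarrow> bool" where
  "radius_le G B r \<longleftrightarrow> (\<exists>c\<in>B. \<forall>x\<in>B. walk_within G B r c x)"

text \<open>H is an r-shallow minor of G (model / branch-set formulation of contracting
  pairwise disjoint subgraphs of radius at most r in a subgraph of G).\<close>
definition shallow_minor :: "nat \<Rightarrow> 'b graph \<Rightarrow> 'a graph \<Rightarrow> bool" where
  "shallow_minor r H G \<longleftrightarrow> is_graph H \<and>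
     (\<exists>\<phi> :: 'b \<Rightarrow> 'a set.
        (\<forall>v\<in>verts H. \<phi> v \<subseteq> verts G \<and> \<phi> v \<noteq> {} \<and> radius_le G (\<phi> v) r) \<and>
        (\<forall>u\<in>verts H. \<forall>v\<in>verts H. u \<noteq> v \<longrightarrow> \<phi> u \<inter> \<phi> v = {}) \<and>
        (\<forall>u v. {u, v} \<in> edges H \<longrightarrow> (\<exists>x\<in>\<phi> u. \<exists>y\<in>\<phi> v. {x, y} \<in> edges G)))"

definition density :: "'a graph \<Rightarrow> real" where
  "density H = real (card (edges H)) / real (card (verts H))"

text \<open>Density is invariant under isomorphism and every shallow minor of G is isomorphic
  to one whose vertices are labelled by elements of the vertex type of G, so it suffices
  to quantify over minors of the same vertex type.\<close>
definition expansion_bounded_by :: "'a graph \<Rightarrow> (nat \<Rightarrow> real) \<Rightarrow> bool" where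
  "expansion_bounded_by G f \<longleftrightarrow> (\<forall>r (H :: 'a graph). shallow_minor r H G \<longrightarrow> density H \<le> f r)"

definition polynomial_expansion :: "'a graph set \<Rightarrow> bool" where
  "polynomial_expansion \<G> \<longleftrightarrow> (\<exists>p :: real poly. (\<forall>r::nat. poly p (real r) \<ge> 0) \<and>
      (\<forall>G\<in>\<G>. expansion_bounded_by G (\<lambda>r. poly p (real r))))"

definition is_property :: "('a graph \<Rightarrow> 'a set \<Rightarrow> bool) \<Rightarrow> bool" where
  "is_property \<pi> \<longleftrightarrow> (\<forall>G Z. is_graph G \<and> \<pi> G Z \<longrightarrow> Z \<noteq> {} \<and> Z \<subseteq> verts G)"

definition finite_diameter :: "('a graph \<Rightarrow> 'a set \<Rightarrow> bool) \<Rightarrow> bool" where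
  "finite_diameter \<pi> \<longleftrightarrow> (\<exists>D::nat. \<forall>G Z. is_graph G \<and> \<pi> G Z \<longrightarrow>
      (\<forall>u\<in>Z. \<forall>v\<in>Z. walk_within G Z D u v))"

definition hitting_set :: "('a graph \<Rightarrow> 'a set \<Rightarrow> bool) \<Rightarrow> 'a graph \<Rightarrow> 'a set \<Rightarrow> bool" where
  "hitting_set \<pi> G X \<longleftrightarrow> X \<subseteq> verts G \<and> (\<forall>Z. Z \<subseteq> verts G \<and> \<pi> G Z \<longrightarrow> X \<inter> Z \<noteq> {})"

definition gamma :: "('a graph \<Rightarrow> 'a set \<Rightarrow> bool) \<Rightarrow> 'a graph \<Rightarrow> nat" where
  "gamma \<pi> G = Min {card X | X. hitting_set \<pi> G X}"

definition symdiff :: "'a set \<Rightarrow> 'a set \<Rightarrow> 'a set" where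
  "symdiff X Y = (X - Y) \<union> (Y - X)"

definition ls_step :: "('a graph \<Rightarrow> 'a set \<Rightarrow> bool) \<Rightarrow> nat \<Rightarrow> 'a graph \<Rightarrow> 'a set \<Rightarrow> 'a set \<Rightarrow> bool" where
  "ls_step \<pi> c G X X' \<longleftrightarrow> (\<exists>Y. Y \<subseteq> verts G \<and> card Y \<le> c \<and>
      card (symdiff X Y) < card X \<and> hitting_set \<pi> G (symdiff X Y) \<and> X' = symdiff X Y)"

text \<open>X can be returned by the c-local search (for some order of iteration over the sets Y):
  X is reachable from V(G) by improving steps and admits no further improving step.\<close>
definition ls_returns :: "('a graph \<Rightarrow> 'a set \<Rightarrow> bool) \<Rightarrow> nat \<Rightarrow> 'a graph \<Rightarrow> 'a set \<Rightarrow> bool" where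
  "ls_returns \<pi> c G X \<longleftrightarrow> (ls_step \<pi> c G)\<^sup>*\<^sup>* (verts G) X \<and> \<not> (\<exists>X'. ls_step \<pi> c G X X')"

end

(*
  Let X be locally optimal and Opt optimal. A closure argument gives a set A containing both, with
  card A = O(card (X \<union> Opt)), such that every vertex outside A sees, through short walks avoiding A,
  only boundedly many vertices of A. The overlay graph on A joins two vertices whose cells
  (vertices reached by short walks outside A) touch; a set Z of bounded diameter that meets X and
  Opt then contains an overlay walk inside Z \<inter> A from X to Opt. Each vertex of G lies in boundedly
  many cells, so by random sampling a shallow clique minor of the overlay yields a dense shallow
  minor of G. Hence the overlay has no large shallow clique minors, and the argument of Plotkin,
  Rao and Smith gives it separators of size O(n / log^2 n). Splitting recursively produces pieces
  of bounded size whose boundaries have total size at most a small fraction of card A. In each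
  piece, replacing the interior part of X by the boundary and the part of Opt keeps a hitting set,
  so local optimality bounds that part of X; summing over the pieces gives the claim.
*)

theory Submission
  imports Defs "HOL-Library.FuncSet"
begin

section \<open>Walks and shallow minors\<close>

text \<open>Separators of \<open>G\<close> itself would be charged to \<open>verts G\<close>, which
  may be far larger than X and Opt; hence the work takes place on a graph on \<open>A\<close>.
  Without the closure that graph could be complete: a single outside vertex adjacent to all of
  \<open>A\<close> would make any two cells touch. The exponent 2 in n / log^2 n comes from the
  recursion. Splitting a piece of size about (4/3)^j duplicates a fraction of at most 2 / j^2 of it,
  and these losses are summable over the levels j, with a tail that tends to 0; losses of order 1 /
  j would not be. Polynomial expansion enters because search radius, minor depth and excluded clique
  size are all bounded by polynomials in j, hence negligible against (4/3)^j. Cells overlap, so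
  branch sets of the overlay do not give disjoint sets in \<open>G\<close>. A sparse random
  subfamily has few conflicts, and a clique is dense enough for many of its edges to
  survive.\<close>

fun reach :: "('a \<Rightarrow> 'a \<Rightarrow> bool) \<Rightarrow> 'a set \<Rightarrow> nat \<Rightarrow> 'a \<Rightarrow> 'a \<Rightarrow> bool" where
  "reach E S 0 u v \<longleftrightarrow> u = v \<and> u \<in> S"
| "reach E S (Suc k) u v \<longleftrightarrow> reach E S k u v \<or> (\<exists>w. reach E S k u w \<and> E w v \<and> v \<in> S)"

text \<open>This is \<open>radius_le\<close> with the centre named. The centre serves as the label
  of a branch set, and sets with a common centre can be united without increasing the
  radius.\<close>

definition centred :: "('a \<Rightarrow> 'a \<Rightarrow> bool) \<Rightarrow> 'a set \<Rightarrow> nat \<Rightarrow> 'a \<Rightarrow> bool" where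
  "centred E B r c \<longleftrightarrow> c \<in> B \<and> (\<forall>x\<in>B. reach E B r c x)"

lemma reach_in: "reach E S k u v \<Longrightarrow> u \<in> S \<and> v \<in> S"
  by (induction k arbitrary: v) auto

lemma reach_refl: "u \<in> S \<Longrightarrow> reach E S k u u"
  by (induction k) auto

lemma reach_mono: "reach E S k u v \<Longrightarrow> k \<le> k' \<Longrightarrow> S \<subseteq> S' \<Longrightarrow> reach E S' k' u v"
proof -
  assume "reach E S k u v" "S \<subseteq> S'" and kk: "k \<le> k'"
  hence "reach E S' k u v" by (induction k arbitrary: v) auto
  with kk show ?thesis by (induction k' rule: dec_induct) auto
qed

lemma reach_trans: "reach E S j u v \<Longrightarrow> reach E S k v w \<Longrightarrow> reach E S (j + k) u w"
proof (induction k arbitrary: w)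
  case 0
  then show ?case by auto
next
  case (Suc k)
  then show ?case by auto
qed

lemma reach_step: "E u v \<Longrightarrow> u \<in> S \<Longrightarrow> v \<in> S \<Longrightarrow> reach E S 1 u v"
  by auto

lemma reach_sym: "symp E \<Longrightarrow> reach E S k u v \<Longrightarrow> reach E S k v u"
proof (induction k arbitrary: v)
  case 0
  then show ?case by auto
next
  case (Suc k)
  show ?case
  proof (cases "reach E S k u v")
    case True
    then show ?thesis using Suc by auto
  next
    case False
    then obtain w where w: "reach E S k u w" "E w v" "v \<in> S" using Suc.prems by auto
    have "reach E S 1 v w" using w reach_in[OF w(1)] sympD[OF Suc.prems(1)]
      by (intro reach_step) auto
    from reach_trans[OF this Suc.IH[OF Suc.prems(1) w(1)]] show ?thesis by simp
  qed
qed

text \<open>\<open>P\<close> is the vertex set of a walk; each of its vertices is reached by a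
  prefix, so \<open>P\<close> is \<open>centred\<close> at \<open>u\<close>. The cardinality bound
  later limits both the sizes of branch sets and the number of conflicts.\<close>

lemma reach_path:
  "reach E S k u v \<Longrightarrow> \<exists>P\<subseteq>S. finite P \<and> card P \<le> k + 1 \<and> v \<in> P \<and> centred E P k u"
proof (induction k arbitrary: v)
  case 0
  then show ?case by (intro exI[of _ "{u}"]) (auto simp: centred_def)
next
  case (Suc k)
  show ?case
  proof (cases "reach E S k u v")
    case True
    then obtain P where "P \<subseteq> S" "finite P" "card P \<le> k + 1" "v \<in> P" "centred E P k u"
      using Suc.IH by blast
    then show ?thesis by (intro exI[of _ P]) (auto simp: centred_def)
  next
    case False
    then obtain w where w: "reach E S k u w" "E w v" "v \<in> S" using Suc.prems by auto
    then obtain P where P: "P \<subseteq> S" "finite P" "card P \<le> k + 1" "w \<in> P" "centred E P k u"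
      using Suc.IH by blast
    have "reach E (insert v P) (Suc k) u x" if "x \<in> insert v P" for x
    proof (cases "x \<in> P")
      case True
      then have "reach E P k u x" using P by (auto simp: centred_def)
      then show ?thesis by (rule reach_mono) auto
    next
      case False
      have "reach E P k u w" using P by (auto simp: centred_def)
      then have "reach E (insert v P) k u w" by (rule reach_mono) auto
      then show ?thesis using w that False by auto
    qed
    moreover have "card (insert v P) \<le> Suc k + 1"
      using P by (metis Suc_eq_plus1 Suc_le_mono card_insert_le_m1 card_insert_if le_SucI)
    ultimately show ?thesis using P w
      by (intro exI[of _ "insert v P"]) (auto simp: centred_def)
  qed
qed

text \<open>A walk to a vertex of the ball stays in the ball, since its prefixes are no longer than
  the walk.\<close>

lemma centred_ball:
  assumes "c \<in> S"
  shows "centred E {v. reach E S k c v} k c"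
  unfolding centred_def
proof (intro conjI ballI)
  show "c \<in> {v. reach E S k c v}" using assms by (simp add: reach_refl)
next
  fix x assume "x \<in> {v. reach E S k c v}"
  then obtain P where P: "P \<subseteq> S" "x \<in> P" "centred E P k c"
    using reach_path[of E S k c x] by blast
  have "P \<subseteq> {v. reach E S k c v}"
    using P by (auto simp: centred_def intro: reach_mono)
  then show "reach E {v. reach E S k c v} k c x"
    using P by (auto simp: centred_def intro: reach_mono)
qed

lemma centred_Union:
  assumes "\<P> \<noteq> {}" "\<And>P. P \<in> \<P> \<Longrightarrow> centred E P r c"
  shows "centred E (\<Union>\<P>) r c"
  using assms unfolding centred_def by (blast intro: reach_mono[OF _ order_refl])

abbreviation adj :: "'a graph \<Rightarrow> 'a \<Rightarrow> 'a \<Rightarrow> bool" where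
  "adj G x y \<equiv> {x, y} \<in> edges G"

lemma symp_adj: "symp (adj G)"
  by (auto simp: symp_def insert_commute)

lemma walk_within_iff_reach: "walk_within G S k u v \<longleftrightarrow> reach (adj G) S k u v"
proof
  assume "walk_within G S k u v"
  then obtain ps where "ps \<noteq> []" "hd ps = u" "last ps = v" "length ps \<le> k + 1" "set ps \<subseteq> S"
    "\<forall>i. i + 1 < length ps \<longrightarrow> {ps ! i, ps ! (i + 1)} \<in> edges G"
    unfolding walk_within_def by blast
  then show "reach (adj G) S k u v"
  proof (induction ps arbitrary: k v rule: rev_induct)
    case Nil
    then show ?case by simp
  next
    case (snoc x qs)
    show ?case
    proof (cases "qs = []")
      case True
      then show ?thesis using snoc.prems by (auto intro: reach_refl)
    next
      case False
      then obtain k' where k': "k = Suc k'" using snoc.prems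
        by (cases k) auto
      have e: "\<forall>i. i + 1 < length qs \<longrightarrow> {qs ! i, qs ! (i + 1)} \<in> edges G"
      proof (intro allI impI)
        fix i assume "i + 1 < length qs"
        then show "{qs ! i, qs ! (i + 1)} \<in> edges G"
          using snoc.prems(6)[rule_format, of i] by (simp add: nth_append)
      qed
      have "reach (adj G) S k' u (last qs)"
        using snoc.prems False k' e by (intro snoc.IH) auto
      moreover have "adj G (last qs) x"
        using snoc.prems(6)[rule_format, of "length qs - 1"] False
        by (simp add: nth_append last_conv_nth)
      ultimately show ?thesis using snoc.prems k' by auto
    qed
  qed
next
  assume "reach (adj G) S k u v"
  then show "walk_within G S k u v"
  proof (induction k arbitrary: v)
    case 0
    then show ?case unfolding walk_within_def by (intro exI[of _ "[u]"]) auto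
  next
    case (Suc k)
    show ?case
    proof (cases "reach (adj G) S k u v")
      case True
      then show ?thesis using Suc.IH[of v] unfolding walk_within_def
        by (metis add_Suc le_SucI)
    next
      case False
      then obtain w where w: "reach (adj G) S k u w" "adj G w v" "v \<in> S" using Suc.prems by auto
      from Suc.IH[OF w(1)] obtain ps where ps: "ps \<noteq> []" "hd ps = u" "last ps = w"
        "length ps \<le> k + 1" "set ps \<subseteq> S"
        "\<forall>i. i + 1 < length ps \<longrightarrow> {ps ! i, ps ! (i + 1)} \<in> edges G"
        unfolding walk_within_def by blast
      have "{(ps @ [v]) ! i, (ps @ [v]) ! (i + 1)} \<in> edges G" if "i + 1 < length (ps @ [v])" for i
      proof (cases "i + 1 < length ps")
        case True
        then show ?thesis using ps(6) by (simp add: nth_append)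
      next
        case False
        then have "i = length ps - 1" "i + 1 = length ps" using that ps(1) by auto
        then show ?thesis using ps(1,3) w(2) by (simp add: nth_append last_conv_nth)
      qed
      then show ?thesis unfolding walk_within_def using ps w
        by (intro exI[of _ "ps @ [v]"]) auto
    qed
  qed
qed

text \<open>\<open>expansion_bounded_by\<close> speaks of minors over the vertex type of
  \<open>G\<close>, whereas the branch sets here are indexed by any type. The minor is relabelled by
  the centres \<open>c i\<close>, which are distinct because the branch sets are disjoint.\<close>

lemma minor_edges_le:
  assumes exp: "expansion_bounded_by G f" and fin: "finite I"
    and sub: "\<And>i. i \<in> I \<Longrightarrow> \<Phi> i \<subseteq> verts G"
    and cen: "\<And>i. i \<in> I \<Longrightarrow> centred (adj G) (\<Phi> i) r (c i)"
    and dis: "\<And>i j. i \<in> I \<Longrightarrow> j \<in> I \<Longrightarrow> i \<noteq> j \<Longrightarrow> \<Phi> i \<inter> \<Phi> j = {}"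
    and edg: "\<And>e. e \<in> \<E> \<Longrightarrow> \<exists>i\<in>I. \<exists>j\<in>I. e = {i, j} \<and> i \<noteq> j \<and> (\<exists>x\<in>\<Phi> i. \<exists>y\<in>\<Phi> j. adj G x y)"
  shows "real (card \<E>) \<le> f r * real (card I)"
proof (cases "I = {}")
  case True
  then have "\<E> = {}" using edg by (metis all_not_in_conv)
  then show ?thesis using True by simp
next
  case False
  have cin: "c i \<in> \<Phi> i" if "i \<in> I" for i using cen[OF that] by (simp add: centred_def)
  have inj: "inj_on c I" by (rule inj_onI) (metis cin dis disjoint_iff)
  define H :: "'a graph" where "H = (c ` I, (`) c ` \<E>)"
  have vH: "verts H = c ` I" and eH: "edges H = (`) c ` \<E>" by (auto simp: H_def verts_def edges_def)
  define \<phi> where "\<phi> v = \<Phi> (inv_into I c v)" for v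
  have \<phi>c: "\<phi> (c i) = \<Phi> i" if "i \<in> I" for i using that inj by (simp add: \<phi>_def)
  have "is_graph H" unfolding is_graph_def
  proof (intro conjI ballI)
    show "finite (verts H)" using fin vH by simp
    fix e assume "e \<in> edges H"
    then obtain e' where "e' \<in> \<E>" "e = c ` e'" using eH by auto
    with edg obtain i j where "i \<in> I" "j \<in> I" "i \<noteq> j" "e = {c i, c j}" by fastforce
    then show "\<exists>u v. e = {u, v} \<and> u \<noteq> v \<and> u \<in> verts H \<and> v \<in> verts H"
      using inj vH by (metis imageI inj_on_contraD)
  qed
  moreover have "\<exists>x\<in>\<phi> u. \<exists>y\<in>\<phi> v. {x, y} \<in> edges G" if uv: "{u, v} \<in> edges H" for u v
  proof -
    from uv obtain e' where "e' \<in> \<E>" "{u, v} = c ` e'" using eH by auto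
    with edg obtain i j where ij: "i \<in> I" "j \<in> I" "{u, v} = {c i, c j}"
      "\<exists>x\<in>\<Phi> i. \<exists>y\<in>\<Phi> j. adj G x y" by fastforce
    then consider "u = c i" "v = c j" | "u = c j" "v = c i" by (auto simp: doubleton_eq_iff)
    then show ?thesis
      using ij \<phi>c by cases (auto, metis insert_commute)
  qed
  ultimately have "shallow_minor r H G"
    unfolding shallow_minor_def
  proof (intro conjI exI[of _ \<phi>] ballI impI allI, goal_cases)
    case (1)
    then show ?case by blast
  next
    case (2 v)
    then obtain i where "i \<in> I" "v = c i" using vH by auto
    then show ?case using \<phi>c sub[of i] by simp
  next
    case (3 v)
    then obtain i where "i \<in> I" "v = c i" using vH by auto
    then show ?case using \<phi>c cin[of i] by auto
  next
    case (4 v)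
    then obtain i where "i \<in> I" "v = c i" using vH by auto
    then show ?case using cen[of i] \<phi>c
      unfolding radius_le_def centred_def walk_within_iff_reach by auto
  next
    case (5 u v)
    then obtain i j where "i \<in> I" "v = c i" "j \<in> I" "u = c j" "i \<noteq> j" using vH by auto
    then show ?case using \<phi>c dis by auto
  next
    case (6 u v)
    then show ?case by blast
  qed
  then have "density H \<le> f r" using exp unfolding expansion_bounded_by_def by blast
  moreover have "card (verts H) = card I" using vH inj by (simp add: card_image)
  moreover have "\<E> \<subseteq> Pow I" using edg by blast
  then have "inj_on ((`) c) \<E>" using inj inj_on_image_Pow inj_on_subset by blast
  then have "card (edges H) = card \<E>" using eH by (simp add: card_image)
  moreover have "card I > 0" using False fin by (simp add: card_gt_0_iff)
  ultimately show ?thesis by (simp add: density_def field_simps)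
qed

section \<open>Separators from excluded shallow cliques\<close>

definition clique_model :: "('a \<Rightarrow> 'a \<Rightarrow> bool) \<Rightarrow> 'a set \<Rightarrow> nat \<Rightarrow> 'a set set \<Rightarrow> bool" where
  "clique_model E V r \<M> \<longleftrightarrow> finite \<M> \<and>
     (\<forall>M\<in>\<M>. M \<subseteq> V \<and> (\<exists>c. centred E M r c)) \<and>
     (\<forall>M\<in>\<M>. \<forall>N\<in>\<M>. M \<noteq> N \<longrightarrow> M \<inter> N = {} \<and> (\<exists>x\<in>M. \<exists>y\<in>N. E x y))"

definition separation :: "('a \<Rightarrow> 'a \<Rightarrow> bool) \<Rightarrow> 'a set \<Rightarrow> 'a set \<Rightarrow> 'a set \<Rightarrow> bool" where
  "separation E V A B \<longleftrightarrow> A \<union> B = V \<and> (\<forall>x\<in>A - B. \<forall>y\<in>B - A. \<not> E x y)"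

text \<open>Otherwise each of the first \<open>d\<close> layers would enlarge the ball by a factor
  of more than \<open>1 + 1 / l\<close>, and the ball of radius \<open>d\<close> would have at least
  \<open>(1 + 1 / l) ^ d\<close> vertices, more than \<open>W\<close> holds.\<close>

lemma slow_ball:
  assumes fin: "finite W" and v: "v \<in> W" and l: "l > 0"
    and d: "real (card W) < (1 + 1 / l) ^ d"
  shows "\<exists>j<d. l * real (card ({u. reach E W (Suc j) v u} - {u. reach E W j v u}))
                \<le> real (card {u. reach E W j v u})"
proof (rule ccontr)
  define B where "B j = {u. reach E W j v u}" for j
  assume "\<not> ?thesis"
  then have big: "l * real (card (B (Suc j) - B j)) > real (card (B j))" if "j < d" for j
    using that by (auto simp: B_def not_le)
  have BW: "B j \<subseteq> W" for j using reach_in by (fastforce simp: B_def)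
  have fB: "finite (B j)" for j using BW fin finite_subset by blast
  have mono: "B j \<subseteq> B (Suc j)" for j by (auto simp: B_def)
  have "(1 + 1 / l) ^ j \<le> real (card (B j))" if "j \<le> d" for j
    using that
  proof (induction j)
    case 0
    have "B 0 = {v}" using v by (auto simp: B_def)
    then show ?case by simp
  next
    case (Suc j)
    have "card (B (Suc j)) = card (B j) + card (B (Suc j) - B j)"
      using fB mono by (metis card_Diff_subset card_mono le_add_diff_inverse)
    moreover have "real (card (B j)) / l \<le> real (card (B (Suc j) - B j))"
      using big[of j] Suc.prems l by (simp add: field_simps)
    ultimately have "real (card (B j)) * (1 + 1 / l) \<le> real (card (B (Suc j)))"
      using l by (simp add: field_simps)
    moreover have "(1 + 1 / l) ^ Suc j \<le> real (card (B j)) * (1 + 1 / l)"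
      using mult_right_mono[of "(1 + 1 / l) ^ j" "real (card (B j))" "1 + 1 / l"] Suc l
      by (simp add: mult.commute)
    ultimately show ?case by linarith
  qed
  from this[of d] have "(1 + 1 / l) ^ d \<le> real (card (B d))" by simp
  also have "\<dots> \<le> real (card W)" using BW fin by (simp add: card_mono)
  finally show False using d by simp
qed


text \<open>The unexplored set \<open>W\<close> is eroded while it holds more than two thirds of
  \<open>V\<close>. A branch set without neighbours in \<open>W\<close> is discarded into
  \<open>R\<close>. Otherwise either some vertex of \<open>W\<close> is close to neighbours of all
  branch sets and the model grows, or two vertices far apart have disjoint balls, one of which
  occupies at most half of \<open>W\<close> and has a thin layer to cut along. The model never
  attains \<open>h\<close> branch sets, so the search ends with a separator made of layers and the
  current branch sets.\<close>

theorem separation_or_clique_model: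
  assumes fin: "finite V" and sym: "symp E" and l: "l > 0" and h: "h \<ge> 1"
    and d: "real (card V) < (1 + 1 / l) ^ d"
    and nc: "\<And>\<M>. clique_model E V (2 * d) \<M> \<Longrightarrow> card \<M> \<noteq> h"
  defines "s \<equiv> real (card V) / l + real (h * (h * (2 * d + 1)))"
  shows "\<exists>A B. separation E V A B \<and> real (card (A \<inter> B)) \<le> s \<and>
    real (card A) \<le> 2 * real (card V) / 3 + s \<and> real (card B) \<le> 2 * real (card V) / 3 + s"
proof -
  \<comment> \<open>Bound on a branch set: one vertex and fewer than \<open>h\<close> walks of at
    most \<open>2 * d + 1\<close> vertices each.\<close>
  define m where "m = h * (2 * d + 1)"
  \<comment> \<open>\<open>R\<close> is already cut off from the unexplored part \<open>W\<close> by \<open>S\<close> and the branch sets \<open>\<M>\<close>.\<close>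
  define state where "state R S \<M> W \<longleftrightarrow> V = R \<union> S \<union> \<Union>\<M> \<union> W \<and> R \<inter> W = {} \<and> \<Union>\<M> \<inter> W = {} \<and>
    (\<forall>x\<in>R. \<forall>y\<in>W. \<not> E x y) \<and> clique_model E V (2 * d) \<M> \<and> (\<forall>M\<in>\<M>. card M \<le> m) \<and>
    card \<M> < h \<and> l * real (card S) \<le> real (card R) \<and> card V \<le> 3 * card W + 3 * m" for R S \<M> W
  have "state R S \<M> W \<Longrightarrow> ?thesis" for R S \<M> W
  \<comment> \<open>Cuts and new branch sets shrink \<open>W\<close>, discarding shrinks
    \<open>\<M>\<close>. A new branch set raises \<open>card \<M>\<close> by one, which the weight
    \<open>h + 1\<close> of a vertex of \<open>W\<close> outweighs.\<close>
  proof (induction "card W * (h + 1) + card \<M>" arbitrary: R S \<M> W rule: less_induct)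
    case less
    from less.prems have V: "V = R \<union> S \<union> \<Union>\<M> \<union> W" and RW: "R \<inter> W = {}" and MW: "\<Union>\<M> \<inter> W = {}"
      and RWE: "\<And>x y. x \<in> R \<Longrightarrow> y \<in> W \<Longrightarrow> \<not> E x y" and cm: "clique_model E V (2 * d) \<M>"
      and cardM: "\<And>M. M \<in> \<M> \<Longrightarrow> card M \<le> m" and kh: "card \<M> < h"
      and lS: "l * real (card S) \<le> real (card R)" and Wm: "card V \<le> 3 * card W + 3 * m"
      unfolding state_def by blast+
    have finM: "finite \<M>" using cm by (simp add: clique_model_def)
    have fins: "finite R" "finite S" "finite W" "finite (\<Union>\<M>)"
      using fin V by (metis finite_Un)+
    have Msub: "M \<subseteq> V" if "M \<in> \<M>" for M using that V by blast
    have finMM: "finite M" if "M \<in> \<M>" for M using that Msub fin finite_subset by blast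
    show ?case
    proof (cases "3 * card W \<le> 2 * card V")
      case True
      \<comment> \<open>Each reduction of \<open>W\<close> starts above two thirds of
        \<open>card V\<close> and takes at most half of \<open>W\<close> or at most \<open>m\<close>
        vertices. The last conjunct of \<open>state\<close> records this and bounds
        \<open>?A\<close>.\<close>
      let ?A = "V - W" and ?B = "V - R"
      have "separation E V ?A ?B"
        using V RW RWE sym unfolding separation_def by blast
      moreover have AB: "?A \<inter> ?B \<subseteq> S \<union> \<Union>\<M>" and BB: "?B \<subseteq> W \<union> (S \<union> \<Union>\<M>)" using V by auto
      have U: "card (\<Union>\<M>) \<le> h * m"
      proof -
        have "card (\<Union>\<M>) \<le> (\<Sum>M\<in>\<M>. card M)" by (rule card_Union_le_sum_card)
        also have "\<dots> \<le> card \<M> * m" using sum_bounded_above[of \<M> card m] cardM by simp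
        also have "\<dots> \<le> h * m" using kh by simp
        finally show ?thesis .
      qed
      have "real (card S) \<le> real (card V) / l"
      proof -
        have "card R \<le> card V" using V fin by (intro card_mono) auto
        then show ?thesis using lS l by (simp add: field_simps)
      qed
      then have SM: "real (card (S \<union> \<Union>\<M>)) \<le> s"
        using card_Un_le[of S "\<Union>\<M>"] U unfolding s_def m_def by linarith
      have "real (card (?A \<inter> ?B)) \<le> s"
        using card_mono[OF _ AB] fins SM by fastforce
      moreover have "card ?A = card V - card W"
        using V fins by (intro card_Diff_subset) auto
      then have "real (card ?A) \<le> 2 * real (card V) / 3 + s"
      proof -
        have "m \<le> h * m" using h by (cases h) auto
        then have "real m \<le> real (h * m)" by linarith
        moreover have "real (card V) / l \<ge> 0" using l by simp
        ultimately have "real m \<le> s" unfolding s_def m_def by linarith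
        moreover have "real (card ?A) = real (card V) - real (card W)"
          using \<open>card ?A = _\<close> card_mono[OF fin, of W] V by auto
        moreover have "real (card V) \<le> 3 * real (card W) + 3 * real m"
          using Wm by linarith
        ultimately show ?thesis by simp
      qed
      moreover have "real (card ?B) \<le> 2 * real (card V) / 3 + s"
      proof -
        have "card ?B \<le> card W + card (S \<union> \<Union>\<M>)"
          using card_mono[OF _ BB] card_Un_le[of W "S \<union> \<Union>\<M>"] fins by fastforce
        moreover have "3 * real (card W) \<le> 2 * real (card V)" using True by linarith
        ultimately show ?thesis using SM by linarith
      qed
      ultimately show ?thesis by blast
    next
      case big: False
      \<comment> \<open>The ball moves to \<open>R\<close> and its outer layer to \<open>S\<close>;
        \<open>thin\<close> charges the layer to the ball, which preserves
        \<open>l * card S \<le> card R\<close>.\<close>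
      have cut: ?thesis if v: "v \<in> W" and j: "j < d"
        and small: "2 * card {u. reach E W d v u} \<le> card W"
        and thin: "l * real (card ({u. reach E W (Suc j) v u} - {u. reach E W j v u}))
                \<le> real (card {u. reach E W j v u})" for v j
      proof -
        define B0 where "B0 = {u. reach E W j v u}"
        define B1 where "B1 = {u. reach E W (Suc j) v u}"
        have B01: "B0 \<subseteq> B1" "B1 \<subseteq> W" using reach_in by (fastforce simp: B0_def B1_def)+
        have finB: "finite B1" "finite B0" using B01 fins finite_subset by metis+
        have "B1 \<subseteq> {u. reach E W d v u}" using j by (auto simp: B1_def simp del: reach.simps intro: reach_mono)
        then have "card B1 \<le> card {u. reach E W d v u}"
          using fins reach_in by (intro card_mono) (fastforce intro: finite_subset[of _ W])+
        then have c1: "2 * card B1 \<le> card W" using small by linarith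
        have cW: "card (W - B1) = card W - card B1" using finB B01 by (intro card_Diff_subset)
        have vB: "v \<in> B1" using v by (auto simp: B1_def intro: reach_refl)
        then have "card B1 > 0" using finB by (auto simp: card_gt_0_iff)
        then have "card (W - B1) < card W" using cW c1 by linarith
        then have less1: "card (W - B1) * (h + 1) + card \<M> < card W * (h + 1) + card \<M>"
          by (simp del: mult_Suc_right)
        have "state (R \<union> B0) (S \<union> (B1 - B0)) \<M> (W - B1)"
          unfolding state_def
        proof (intro conjI ballI)
          show "V = R \<union> B0 \<union> (S \<union> (B1 - B0)) \<union> \<Union> \<M> \<union> (W - B1)" using V B01 by blast
          show "(R \<union> B0) \<inter> (W - B1) = {}" using RW B01 by blast
          show "\<Union> \<M> \<inter> (W - B1) = {}" using MW by blast
          show "\<not> E x y" if "x \<in> R \<union> B0" "y \<in> W - B1" for x y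
            using that RWE by (auto simp: B0_def B1_def)
          show "clique_model E V (2 * d) \<M>" by fact
          show "card M \<le> m" if "M \<in> \<M>" for M using that cardM by blast
          show "card \<M> < h" by fact
          have "card (R \<union> B0) = card R + card B0"
            using fins finB RW B01 by (intro card_Un_disjoint) auto
          moreover have "l * real (card (S \<union> (B1 - B0))) \<le> l * real (card S) + l * real (card (B1 - B0))"
            using card_Un_le[of S "B1 - B0"] l by (simp flip: distrib_left of_nat_add)
          ultimately show "l * real (card (S \<union> (B1 - B0))) \<le> real (card (R \<union> B0))"
            using lS thin by (simp add: B0_def B1_def)
          show "card V \<le> 3 * card (W - B1) + 3 * m" using cW c1 big by linarith
        qed
        from less.hyps[OF less1 this] show ?thesis .
      qed
      show ?thesis
      proof (cases "\<exists>M\<in>\<M>. \<forall>x\<in>M. \<forall>y\<in>W. \<not> E x y")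
        case True
        then obtain M where M: "M \<in> \<M>" "\<And>x y. x \<in> M \<Longrightarrow> y \<in> W \<Longrightarrow> \<not> E x y" by blast
        have cM: "card (\<M> - {M}) < card \<M>" using M finM by (meson card_Diff1_less)
        have "state (R \<union> M) S (\<M> - {M}) W"
          unfolding state_def
        proof (intro conjI ballI)
          show "V = R \<union> M \<union> S \<union> \<Union> (\<M> - {M}) \<union> W" using V M by blast
          show "(R \<union> M) \<inter> W = {}" using RW MW M by blast
          show "\<Union> (\<M> - {M}) \<inter> W = {}" using MW by blast
          show "\<not> E x y" if "x \<in> R \<union> M" "y \<in> W" for x y using that RWE M by blast
          show "clique_model E V (2 * d) (\<M> - {M})" using cm unfolding clique_model_def by simp
          show "card M' \<le> m" if "M' \<in> \<M> - {M}" for M' using that cardM by blast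
          show "card (\<M> - {M}) < h" using cM kh by linarith
          have "card R \<le> card (R \<union> M)" using fins finMM M by (intro card_mono) auto
          then show "l * real (card S) \<le> real (card (R \<union> M))" using lS by linarith
          show "card V \<le> 3 * card W + 3 * m" by fact
        qed
        then show ?thesis using less.hyps[of W "\<M> - {M}"] cM by simp
      next
        case False
        then have "\<forall>M\<in>\<M>. \<exists>y\<in>W. \<exists>x\<in>M. E x y" by blast
        then obtain a where a: "\<And>M. M \<in> \<M> \<Longrightarrow> a M \<in> W \<and> (\<exists>x\<in>M. E x (a M))" by metis
        have "W \<noteq> {}" using big by auto
        then obtain v where v: "v \<in> W" by blast
        have cWV: "real (card W) < (1 + 1 / l) ^ d"
          using d card_mono[OF fin, of W] V by force
        show ?thesis
        proof (cases "\<forall>M\<in>\<M>. reach E W (2 * d) v (a M)")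
          case True
          then have "\<forall>M\<in>\<M>. \<exists>P\<subseteq>W. finite P \<and> card P \<le> 2 * d + 1 \<and> a M \<in> P \<and> centred E P (2 * d) v"
            using reach_path by metis
          then obtain P where P: "\<And>M. M \<in> \<M> \<Longrightarrow> P M \<subseteq> W \<and> finite (P M) \<and> card (P M) \<le> 2 * d + 1 \<and>
              a M \<in> P M \<and> centred E (P M) (2 * d) v" by metis
          \<comment> \<open>The singleton keeps \<open>N\<close> nonempty while \<open>\<M>\<close>
            is still empty.\<close>
          define N where "N = \<Union>(insert {v} (P ` \<M>))"
          have NW: "N \<subseteq> W" using P v by (auto simp: N_def)
          have cenN: "centred E N (2 * d) v" unfolding N_def
            by (rule centred_Union) (auto simp: P, auto simp: centred_def intro: reach_refl)
          have vN: "v \<in> N" by (simp add: N_def)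
          have cN: "card N \<le> m"
          proof -
            have "card (\<Union>(P ` \<M>)) \<le> (\<Sum>M\<in>\<M>. card (P M))"
              using finM by (rule card_UN_le)
            also have "\<dots> \<le> card \<M> * (2 * d + 1)" using sum_bounded_above[of \<M> "\<lambda>M. card (P M)" "2 * d + 1"] P by simp
            finally have "card (\<Union>(P ` \<M>)) \<le> card \<M> * (2 * d + 1)" .
            moreover have "card N \<le> 1 + card (\<Union>(P ` \<M>))"
              using card_Un_le[of "{v}" "\<Union>(P ` \<M>)"] by (simp add: N_def)
            moreover have "(card \<M> + 1) * (2 * d + 1) \<le> h * (2 * d + 1)"
              using kh by (intro mult_le_mono1) simp
            ultimately show ?thesis by (simp add: m_def)
          qed
          have Nnew: "N \<notin> \<M>" using NW MW vN by blast
          have cmN: "clique_model E V (2 * d) (insert N \<M>)"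
          proof -
            have NM: "M \<inter> N = {} \<and> (\<exists>x\<in>M. \<exists>y\<in>N. E x y)" if "M \<in> \<M>" for M
              using that MW NW a[OF that] P[OF that] by (auto simp: N_def)
            then have "N \<inter> M = {} \<and> (\<exists>x\<in>N. \<exists>y\<in>M. E x y)" if "M \<in> \<M>" for M
              using that sympD[OF sym] by (metis inf_commute)
            then show ?thesis
              using cm NM NW V cenN unfolding clique_model_def by auto
          qed
          have "card (insert N \<M>) = card \<M> + 1" using Nnew finM by simp
          moreover have "card (insert N \<M>) \<noteq> h" using nc cmN by blast
          ultimately have kh': "card (insert N \<M>) < h" using kh by linarith
          have finN: "finite N" using NW fins finite_subset by metis
          have cWN: "card (W - N) = card W - card N" using finN NW by (intro card_Diff_subset)
          have "card N > 0" using finN vN by (auto simp: card_gt_0_iff)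
          moreover have "card N \<le> card W" using NW fins by (intro card_mono)
          ultimately have "card (W - N) + 1 \<le> card W" using cWN by linarith
          then have "(card (W - N) + 1) * (h + 1) \<le> card W * (h + 1)" by (intro mult_le_mono1)
          then have less1: "card (W - N) * (h + 1) + card (insert N \<M>) < card W * (h + 1) + card \<M>"
            using \<open>card (insert N \<M>) = _\<close> h by simp
          have "state R S (insert N \<M>) (W - N)"
            unfolding state_def
          proof (intro conjI ballI)
            show "V = R \<union> S \<union> \<Union> (insert N \<M>) \<union> (W - N)" using V NW by blast
            show "R \<inter> (W - N) = {}" using RW by blast
            show "\<Union> (insert N \<M>) \<inter> (W - N) = {}" using MW by blast
            show "\<not> E x y" if "x \<in> R" "y \<in> W - N" for x y using that RWE by blast
            show "clique_model E V (2 * d) (insert N \<M>)" by fact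
            show "card M \<le> m" if "M \<in> insert N \<M>" for M using that cardM cN by blast
            show "card (insert N \<M>) < h" by fact
            show "l * real (card S) \<le> real (card R)" by fact
            show "card V \<le> 3 * card (W - N) + 3 * m" using cWN cN big by linarith
          qed
          from less.hyps[OF less1 this] show ?thesis .
        next
          case False
          then obtain M where M: "M \<in> \<M>" "\<not> reach E W (2 * d) v (a M)" by blast
          have aW: "a M \<in> W" using a M by blast
          let ?D = "\<lambda>v. {u. reach E W d v u}"
          have "?D v \<inter> ?D (a M) = {}"
          proof -
            have "\<not> (reach E W d v u \<and> reach E W d (a M) u)" for u
              using M(2) reach_trans[of E W d v u d "a M"] reach_sym[OF sym, of W d "a M" u]
              by (auto simp: mult_2)
            then show ?thesis by blast
          qed
          moreover have DW: "?D u \<subseteq> W" for u using reach_in by fastforce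
          moreover have "finite (?D u)" for u using DW fins finite_subset by metis
          ultimately have "card (?D v) + card (?D (a M)) \<le> card W"
            using fins by (subst card_Un_disjoint[symmetric]) (auto intro!: card_mono dest: reach_in)
          then consider "2 * card (?D v) \<le> card W" | "2 * card (?D (a M)) \<le> card W" by linarith
          then show ?thesis
            using slow_ball[OF fins(3) v l cWV] slow_ball[OF fins(3) aW l cWV] cut v aW by metis
        qed
      qed
    qed
  qed
  moreover have "state {} {} {} V"
    using h l unfolding state_def clique_model_def by auto
  ultimately show ?thesis by blast
qed

section \<open>Recursive division\<close>

text \<open>A list, so that equal pieces from different branches of the recursion are counted
  separately and can be addressed by position.\<close>

definition division :: "('a \<Rightarrow> 'a \<Rightarrow> bool) \<Rightarrow> 'a set \<Rightarrow> 'a set list \<Rightarrow> bool" where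
  "division E U Ls \<longleftrightarrow> \<Union>(set Ls) = U \<and>
     (\<forall>x\<in>U. \<forall>y\<in>U. E x y \<longrightarrow> (\<exists>L\<in>set Ls. x \<in> L \<and> y \<in> L))"

lemma division_append:
  assumes "separation E U A B" "division E A As" "division E B Bs" "symp E"
  shows "division E U (As @ Bs)"
  unfolding division_def
proof (intro conjI ballI impI)
  show "\<Union> (set (As @ Bs)) = U" using assms by (auto simp: separation_def division_def)
next
  fix x y assume xy: "x \<in> U" "y \<in> U" "E x y"
  have U: "A \<union> B = U" and no: "\<And>x y. x \<in> A - B \<Longrightarrow> y \<in> B - A \<Longrightarrow> \<not> E x y"
    using assms(1) unfolding separation_def by blast+
  have "E y x" using assms(4) xy(3) by (rule sympD)
  with no[of x y] no[of y x] U xy consider "x \<in> A" "y \<in> A" | "x \<in> B" "y \<in> B" by blast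
  then show "\<exists>L\<in>set (As @ Bs). x \<in> L \<and> y \<in> L"
  proof cases
    case 1
    then show ?thesis using assms(2) xy(3) unfolding division_def by auto
  next
    case 2
    then show ?thesis using assms(3) xy(3) unfolding division_def by auto
  qed
qed

text \<open>Both sides of a split have at most 3/4 of the vertices, so a piece between
  \<open>(4/3) ^ j\<close> and \<open>(4/3) ^ Suc j\<close> falls below this window after one split.
  Each level therefore multiplies the total size at most once by \<open>1 + 2 / j\<^sup>2\<close>,
  and the product over \<open>j \<ge> J\<close> stays below \<open>1 + \<epsilon>\<close>.\<close>

lemma division_exists:
  assumes fin: "finite V" and sym: "symp E" and \<epsilon>: "0 < \<epsilon>" "\<epsilon> \<le> 1" and J: "8 / \<epsilon> \<le> real J"
    and sep: "\<And>j U. J \<le> j \<Longrightarrow> U \<subseteq> V \<Longrightarrow> (4/3) ^ j < real (card U) \<Longrightarrow> real (card U) \<le> (4/3) ^ Suc j \<Longrightarrow>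
      \<exists>A B. separation E U A B \<and> real (card (A \<inter> B)) \<le> 2 / (real j)\<^sup>2 * real (card U) \<and>
        real (card A) \<le> 3/4 * real (card U) \<and> real (card B) \<le> 3/4 * real (card U)"
  shows "\<exists>Ls. division E V Ls \<and> (\<forall>L\<in>set Ls. real (card L) \<le> (4/3) ^ J) \<and>
    real (sum_list (map card Ls)) \<le> (1 + \<epsilon>) * real (card V)"
proof -
  \<comment> \<open>Relative size allowed at level \<open>j\<close>; the increments \<open>8 / (j * (j + 1))\<close> pay for the
    factors \<open>1 + 2 / j\<^sup>2\<close>.\<close>
  define w where "w j = 1 + \<epsilon> - 8 / real j" for j :: nat
  have Jpos: "J > 0" 
  proof (rule ccontr)
    assume "\<not> J > 0"
    then show False using \<epsilon> J by simp
  qed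
  have main: "\<exists>Ls. division E U Ls \<and> (\<forall>L\<in>set Ls. real (card L) \<le> (4/3) ^ J) \<and>
      real (sum_list (map card Ls)) \<le> w j * real (card U)"
    if "J \<le> j" "U \<subseteq> V" "real (card U) \<le> (4/3) ^ j" for j U
    using that
  proof (induction j arbitrary: U rule: dec_induct)
    case base
    have "8 / real J \<le> \<epsilon>" using J \<epsilon> Jpos by (simp add: field_simps)
    then have "1 * real (card U) \<le> w J * real (card U)"
      unfolding w_def by (intro mult_right_mono) auto
    then show ?case using base by (intro exI[of _ "[U]"]) (auto simp: division_def)
  next
    case (step j)
    have j0: "real j > 0" using step.hyps Jpos by simp
    \<comment> \<open>\<open>\<epsilon> \<le> 1\<close> gives \<open>w j \<le> 2\<close>, so the
      growth to absorb is at most \<open>4 / j\<^sup>2\<close>, and \<open>j \<ge> 1\<close> bounds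
      this by the increment of \<open>w\<close>.\<close>
    have wmono: "w j * (1 + 2 / (real j)\<^sup>2) \<le> w (Suc j)"
    proof -
      have "w j \<le> 2" 
      proof -
        have "8 / real j \<ge> 0" by simp
        then show ?thesis using \<epsilon> unfolding w_def by linarith
      qed
      then have "w j * (2 / (real j)\<^sup>2) \<le> 2 * (2 / (real j)\<^sup>2)" by (intro mult_right_mono) auto
      also have "\<dots> \<le> 8 / (real j * (real j + 1))"
      proof -
        have "real j * 1 \<le> real j * real j" using j0 by (intro mult_left_mono) auto
        then have "4 * (real j * (real j + 1)) \<le> 8 * (real j)\<^sup>2"
          by (simp add: power2_eq_square algebra_simps)
        moreover have "0 < real j * (real j + 1)" "0 < (real j)\<^sup>2" using j0 by auto
        ultimately have "4 / (real j)\<^sup>2 \<le> 8 / (real j * (real j + 1))"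
          by (simp only: pos_divide_le_eq pos_le_divide_eq times_divide_eq_left)
        then show ?thesis by simp
      qed
      also have "\<dots> = w (Suc j) - w j" 
      proof -
        have "8 / real j - 8 / (real j + 1) = 8 / (real j * (real j + 1))"
          using j0 by (subst diff_frac_eq) auto
        then show ?thesis by (simp add: w_def add.commute)
      qed
      finally show ?thesis by (simp add: algebra_simps)
    qed
    have w0: "w j \<ge> 0"
    proof -
      have "8 / real j \<le> 8 / real J" using step.hyps Jpos by (intro divide_left_mono) auto
      also have "\<dots> \<le> \<epsilon>" using J \<epsilon> Jpos by (simp add: field_simps)
      finally show ?thesis by (simp add: w_def)
    qed
    then have wle: "w j \<le> w (Suc j)" using wmono mult_left_mono[of 1 "1 + 2 / (real j)\<^sup>2" "w j"] by simp
    show ?case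
    proof (cases "real (card U) \<le> (4/3) ^ j")
      case True
      then obtain Ls where "division E U Ls" "\<forall>L\<in>set Ls. real (card L) \<le> (4/3) ^ J"
        "real (sum_list (map card Ls)) \<le> w j * real (card U)" using step.IH step.prems by blast
      then show ?thesis using mult_right_mono[OF wle, of "real (card U)"] by (intro exI[of _ Ls]) auto
    next
      case False
      then obtain A B where AB: "separation E U A B" "real (card (A \<inter> B)) \<le> 2 / (real j)\<^sup>2 * real (card U)"
        "real (card A) \<le> 3/4 * real (card U)" "real (card B) \<le> 3/4 * real (card U)"
        using sep[of j U] step.hyps step.prems by auto
      have U: "A \<union> B = U" using AB by (simp add: separation_def)
      then have sub: "A \<subseteq> V" "B \<subseteq> V" using step.prems by auto
      have "3/4 * real (card U) \<le> (4/3) ^ j" using step.prems by simp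
      then have "real (card A) \<le> (4/3) ^ j" "real (card B) \<le> (4/3) ^ j" using AB by linarith+
      with step.IH sub obtain As Bs where
        As: "division E A As" "\<forall>L\<in>set As. real (card L) \<le> (4/3) ^ J"
          "real (sum_list (map card As)) \<le> w j * real (card A)" and
        Bs: "division E B Bs" "\<forall>L\<in>set Bs. real (card L) \<le> (4/3) ^ J"
          "real (sum_list (map card Bs)) \<le> w j * real (card B)" by metis
      have "card A + card B = card U + card (A \<inter> B)"
        using card_Un_Int[of A B] sub fin U finite_subset by metis
      then have "real (card A) + real (card B) = real (card U) + real (card (A \<inter> B))" by linarith
      also have "\<dots> \<le> (1 + 2 / (real j)\<^sup>2) * real (card U)" using AB(2) by (simp add: algebra_simps)
      finally have "w j * (real (card A) + real (card B)) \<le> w j * ((1 + 2 / (real j)\<^sup>2) * real (card U))"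
        using w0 by (intro mult_left_mono)
      also have "\<dots> \<le> w (Suc j) * real (card U)"
        using mult_right_mono[OF wmono, of "real (card U)"] by (simp add: mult.assoc)
      finally have "real (sum_list (map card (As @ Bs))) \<le> w (Suc j) * real (card U)"
        using As(3) Bs(3) by (simp add: algebra_simps)
      then show ?thesis using division_append[OF AB(1) As(1) Bs(1) sym] As(2) Bs(2)
        by (intro exI[of _ "As @ Bs"]) auto
    qed
  qed
  obtain k where "real (card V) < (4/3) ^ k" using real_arch_pow[of "4/3"] by auto
  also have "\<dots> \<le> (4/3) ^ (max J k)" by (intro power_increasing) auto
  finally obtain Ls where Ls: "division E V Ls" "\<forall>L\<in>set Ls. real (card L) \<le> (4/3) ^ J"
      "real (sum_list (map card Ls)) \<le> w (max J k) * real (card V)"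
    using main[of "max J k" V] by auto
  have "w (max J k) \<le> 1 + \<epsilon>" by (simp add: w_def)
  then have "w (max J k) * real (card V) \<le> (1 + \<epsilon>) * real (card V)" by (intro mult_right_mono) auto
  then show ?thesis using Ls by (intro exI[of _ Ls]) auto
qed

section \<open>Polynomials against exponentials\<close>

text \<open>With \<open>x = y * y\<close>, one factor \<open>y ^ n\<close> absorbs the
  \<open>n\<close> of Horner's rule and the other is left to the induction hypothesis, for which
  \<open>x\<close> is generalised.\<close>

lemma poly_times_power_tendsto_0:
  fixes p :: "real poly" and x :: real
  assumes "0 < x" "x < 1"
  shows "(\<lambda>n. poly p (real n) * x ^ n) \<longlonglongrightarrow> 0"
  using assms
proof (induction p arbitrary: x)
  case 0
  then show ?case by simp
next
  case (pCons a p)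
  define y where "y = sqrt x"
  have y: "0 < y" "y < 1" and xy: "x = y * y" using pCons.prems by (auto simp: y_def)
  have 1: "(\<lambda>n. real n * y ^ n) \<longlonglongrightarrow> 0" using y by (intro powser_times_n_limit_0) auto
  have 2: "(\<lambda>n. x ^ n) \<longlonglongrightarrow> 0" using pCons.prems by (intro LIMSEQ_realpow_zero) auto
  have "(\<lambda>n. a * x ^ n + (real n * y ^ n) * (poly p (real n) * y ^ n)) \<longlonglongrightarrow> a * 0 + 0 * 0"
    by (intro tendsto_intros 1 2 pCons.IH[OF y])
  then show ?case by (simp add: xy power_mult_distrib algebra_simps)
qed

lemma poly_eventually_le_power:
  fixes p :: "real poly"
  assumes "b > 1"
  shows "\<forall>\<^sub>F n in sequentially. poly p (real n) \<le> b ^ n"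
proof -
  have "(\<lambda>n. poly p (real n) * (1 / b) ^ n) \<longlonglongrightarrow> 0"
    using assms by (intro poly_times_power_tendsto_0) auto
  then have "\<forall>\<^sub>F n in sequentially. poly p (real n) * (1 / b) ^ n < 1"
    by (rule order_tendstoD) simp
  then show ?thesis
    by (rule eventually_mono) (use assms in \<open>simp add: field_simps power_one_over\<close>)
qed

section \<open>Shallow cliques with bounded congestion\<close>

text \<open>Counting form of a probability: a uniform colouring \<open>g\<close> puts each index
  into the sample \<open>{i. g i = 0}\<close> independently with probability \<open>1 / K\<close>,
  so the sample contains \<open>T\<close> with probability \<open>1 / K ^ card T\<close>.\<close>

lemma card_colourings_vanishing:
  fixes h K :: nat
  assumes "T \<subseteq> {..<h}" "K > 0"
  shows "(\<Sum>g\<in>{..<h} \<rightarrow>\<^sub>E {..<K}. of_bool (T \<subseteq> {i. i < h \<and> g i = 0})) = real K ^ h / real K ^ card T"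
proof -
  have fT: "finite T" using assms finite_subset by blast
  have "{g \<in> {..<h} \<rightarrow>\<^sub>E {..<K}. T \<subseteq> {i. i < h \<and> g i = 0}} = PiE {..<h} (\<lambda>i. if i \<in> T then {0} else {..<K})"
    (is "?L = ?R")
  proof (intro equalityI subsetI)
    fix g assume "g \<in> ?L"
    then show "g \<in> ?R" by (auto simp: PiE_iff)
  next
    fix g assume g: "g \<in> ?R"
    have "g i = 0" if "i \<in> T" for i using PiE_mem[OF g, of i] that assms by auto
    moreover have "g i < K" if "i < h" for i
      using PiE_mem[OF g, of i] that assms by (auto split: if_splits)
    ultimately show "g \<in> ?L" using g assms by (auto simp: PiE_iff)
  qed
  then have "(\<Sum>g\<in>{..<h} \<rightarrow>\<^sub>E {..<K}. of_bool (T \<subseteq> {i. i < h \<and> g i = 0})) = real (card ?R)"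
    by (simp add: finite_PiE Int_def)
  also have "card ?R = (\<Prod>i\<in>{..<h}. if i \<in> T then 1 else K)"
    by (subst card_PiE) (auto intro!: prod.cong)
  also have "\<dots> = K ^ card ({..<h} - T)"
    by (subst prod.If_cases) (auto simp: Diff_eq)
  also have "card ({..<h} - T) = h - card T" using assms fT by (subst card_Diff_subset) auto
  also have "real (K ^ (h - card T)) = real K ^ h / real K ^ card T"
    unfolding of_nat_power using assms card_mono[of "{..<h}" T] by (simp add: power_diff)
  finally show ?thesis .
qed

lemma sum_lessThan_real: "(\<Sum>j<h. real j) = real h * (real h - 1) / 2"
  by (induction h) (auto simp: field_simps)

text \<open>Sample each index with probability \<open>1 / (2 * k)\<close>: a given pair survives without any of its
  at most \<open>k\<close> conflicting indices with probability at least \<open>1 / (8 * k\<^sup>2)\<close>.\<close>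

lemma sampling_bound:
  fixes F :: real
  assumes k: "k \<ge> 1" and F: "F \<ge> 0"
    and L: "\<And>i j. i < j \<Longrightarrow> j < h \<Longrightarrow> L i j \<subseteq> {..<h} - {i, j}"
    and Lk: "\<And>i j. i < j \<Longrightarrow> j < h \<Longrightarrow> card (L i j) \<le> k"
    and edges: "\<And>J. J \<subseteq> {..<h} \<Longrightarrow>
      real (card {(i, j). i < j \<and> i \<in> J \<and> j \<in> J \<and> L i j \<inter> J = {}}) \<le> F * real (card J)"
  shows "real h \<le> 8 * real k * F + 1"
proof (cases "h = 0")
  case True
  then show ?thesis using F by simp
next
  case False
  \<comment> \<open>With this \<open>K\<close>, the expected loss of a pair to its conflicts, at
    most \<open>k / K ^ 3\<close>, is at most half of the probability \<open>1 / K ^ 2\<close> that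
    the pair is sampled.\<close>
  define K where "K = 2 * k"
  have K0: "K > 0" using k by (simp add: K_def)
  define G where "G = ({..<h} \<rightarrow>\<^sub>E {..<K})"
  define J where "J g = {i. i < h \<and> g i = (0::nat)}" for g
  define pairs where "pairs = (SIGMA j:{..<h}. {..<j})"
  have cnt: "(\<Sum>g\<in>G. of_bool (T \<subseteq> J g)) = real K ^ h / real K ^ card T" if "T \<subseteq> {..<h}" for T
    unfolding G_def J_def using that K0 by (rule card_colourings_vanishing)
  have finp: "finite pairs" by (simp add: pairs_def)
  have fL: "finite (L i j)" if "i < j" "j < h" for i j using L[OF that] finite_subset by blast
  have "(\<Sum>g\<in>G. real (card (J g))) = (\<Sum>g\<in>G. \<Sum>i<h. of_bool ({i} \<subseteq> J g))"
    by (intro sum.cong) (auto simp: J_def Int_def intro!: arg_cong[where f = card])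
  also have "\<dots> = (\<Sum>i<h. real K ^ h / real K)"
    by (subst sum.swap) (use cnt[of "{_}"] in \<open>auto intro!: sum.cong\<close>)
  finally have SJ: "(\<Sum>g\<in>G. real (card (J g))) = real h * (real K ^ h / real K)" by simp
  \<comment> \<open>Union bound, pointwise in \<open>g\<close>: a sampled pair survives unless some
    conflicting index is sampled with it.\<close>
  have pair: "of_bool ({i, j} \<subseteq> J g) - (\<Sum>l\<in>L i j. of_bool ({i, j, l} \<subseteq> J g))
      \<le> (of_bool (i \<in> J g \<and> j \<in> J g \<and> L i j \<inter> J g = {}) :: real)"
    if "i < j" "j < h" for i j g
  proof (cases "{i, j} \<subseteq> J g \<and> L i j \<inter> J g \<noteq> {}")
    case True
    then obtain l where l: "l \<in> L i j" "l \<in> J g" by blast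
    have "(of_bool ({i, j, l} \<subseteq> J g) :: real) \<le> (\<Sum>l\<in>L i j. of_bool ({i, j, l} \<subseteq> J g))"
      using l fL[OF that] by (intro member_le_sum) auto
    then show ?thesis using True l by simp
  next
    case False
    have "(\<Sum>l\<in>L i j. of_bool ({i, j, l} \<subseteq> J g)) \<ge> (0::real)" by (intro sum_nonneg) auto
    then show ?thesis using False by auto
  qed
  have single: "real K ^ h / (2 * real K ^ 2)
      \<le> (\<Sum>g\<in>G. of_bool (i \<in> J g \<and> j \<in> J g \<and> L i j \<inter> J g = {}))"
    if ij: "i < j" "j < h" for i j
  proof -
    have c2: "(\<Sum>g\<in>G. of_bool ({i, j} \<subseteq> J g)) = real K ^ h / real K ^ 2"
    proof -
      have "card {i, j} = 2" "{i, j} \<subseteq> {..<h}" using ij by auto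
      then show ?thesis by (simp only: cnt)
    qed
    have c3: "(\<Sum>g\<in>G. of_bool ({i, j, l} \<subseteq> J g)) = real K ^ h / real K ^ 3" if "l \<in> L i j" for l
    proof -
      have "l \<noteq> i" "l \<noteq> j" "l < h" using L[OF ij] that by auto
      then have "card {i, j, l} = 3" "{i, j, l} \<subseteq> {..<h}" using ij by auto
      then show ?thesis by (simp only: cnt)
    qed
    have "real (card (L i j)) * (real K ^ h / real K ^ 3) \<le> real k * (real K ^ h / real K ^ 3)"
      using Lk[OF ij] by (intro mult_right_mono) auto
    also have "\<dots> = real K ^ h / (2 * real K ^ 2)"
      using k by (simp add: K_def power2_eq_square power3_eq_cube)
    finally have a: "real (card (L i j)) * (real K ^ h / real K ^ 3) \<le> real K ^ h / (2 * real K ^ 2)" .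
    have "real K ^ h / (2 * real K ^ 2) \<le> real K ^ h / real K ^ 2 - real (card (L i j)) * (real K ^ h / real K ^ 3)"
      using a by simp
    also have "\<dots> = (\<Sum>g\<in>G. of_bool ({i, j} \<subseteq> J g)) - (\<Sum>l\<in>L i j. \<Sum>g\<in>G. of_bool ({i, j, l} \<subseteq> J g))"
    proof -
      have "(\<Sum>l\<in>L i j. \<Sum>g\<in>G. of_bool ({i, j, l} \<subseteq> J g)) = (\<Sum>l\<in>L i j. real K ^ h / real K ^ 3)"
        by (intro sum.cong refl c3)
      then show ?thesis by (simp only: c2 sum_constant)
    qed
    also have "\<dots> = (\<Sum>g\<in>G. of_bool ({i, j} \<subseteq> J g) - (\<Sum>l\<in>L i j. of_bool ({i, j, l} \<subseteq> J g)))"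
      by (subst sum.swap) (simp only: sum_subtractf)
    also have "\<dots> \<le> (\<Sum>g\<in>G. of_bool (i \<in> J g \<and> j \<in> J g \<and> L i j \<inter> J g = {}))"
      by (intro sum_mono pair ij)
    finally show ?thesis .
  qed
  have "real (card pairs) = (\<Sum>j<h. real j)" by (simp add: pairs_def)
  then have cp: "real (card pairs) = real h * (real h - 1) / 2" by (simp only: sum_lessThan_real)
  have ed: "(\<Sum>(j, i)\<in>pairs. of_bool (i \<in> J g \<and> j \<in> J g \<and> L i j \<inter> J g = {})) \<le> F * real (card (J g))" for g
  proof -
    define D where "D = {(i, j). i < j \<and> i \<in> J g \<and> j \<in> J g \<and> L i j \<inter> J g = {}}"
    have "(\<Sum>(j, i)\<in>pairs. of_bool (i \<in> J g \<and> j \<in> J g \<and> L i j \<inter> J g = {}))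
        = real (card {p \<in> pairs. snd p \<in> J g \<and> fst p \<in> J g \<and> L (snd p) (fst p) \<inter> J g = {}})"
      using finp by (simp add: split_def Int_def)
    also have "{p \<in> pairs. snd p \<in> J g \<and> fst p \<in> J g \<and> L (snd p) (fst p) \<inter> J g = {}} = prod.swap ` D"
      by (auto simp: pairs_def D_def J_def image_iff)
    also have "card \<dots> = card D" by (intro card_image) auto
    also have "real (card D) \<le> F * real (card (J g))"
      unfolding D_def by (intro edges) (auto simp: J_def)
    finally show ?thesis .
  qed
  \<comment> \<open>The expected number of surviving pairs is compared with \<open>F\<close> times
    the expected sample size \<open>h / K\<close>, both scaled by the number \<open>K ^ h\<close> of
    colourings.\<close>
  have "real h * (real h - 1) / 2 * (real K ^ h / (2 * real K ^ 2)) = (\<Sum>p\<in>pairs. real K ^ h / (2 * real K ^ 2))"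
    by (simp add: cp)
  also have "\<dots> \<le> (\<Sum>(j, i)\<in>pairs. \<Sum>g\<in>G. of_bool (i \<in> J g \<and> j \<in> J g \<and> L i j \<inter> J g = {}))"
    by (intro sum_mono) (use single in \<open>auto simp: pairs_def\<close>)
  also have "\<dots> = (\<Sum>g\<in>G. \<Sum>(j, i)\<in>pairs. of_bool (i \<in> J g \<and> j \<in> J g \<and> L i j \<inter> J g = {}))"
    unfolding split_def by (rule sum.swap)
  also have "\<dots> \<le> (\<Sum>g\<in>G. F * real (card (J g)))" by (intro sum_mono ed)
  also have "\<dots> = F * (real h * (real K ^ h / real K))" by (simp only: SJ flip: sum_distrib_left)
  finally have "(real h * real K ^ h / (4 * real K ^ 2)) * (real h - 1)
      \<le> (real h * real K ^ h / (4 * real K ^ 2)) * (4 * real K * F)"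
    using K0 by (simp add: power2_eq_square mult_ac)
  moreover have "real h * real K ^ h / (4 * real K ^ 2) > 0" using False K0 by simp
  ultimately have "real h - 1 \<le> 4 * real K * F" by (simp only: mult_le_cancel_left_pos)
  then show ?thesis by (simp add: K_def)
qed

text \<open>Take the least \<open>n\<close> for which the ball of radius \<open>n\<close> around
  \<open>b\<close> in \<open>B\<close> touches \<open>A\<close>. This ball avoids \<open>A\<close>:
  for \<open>n = 0\<close> by \<open>b \<notin> A\<close>, and otherwise because a vertex of
  \<open>A\<close> in it would have a predecessor that touches \<open>A\<close> earlier. So
  \<open>Q\<close> misses all of \<open>A\<close>, and the contact is an edge rather than a common
  vertex. This protects \<open>Q\<close> when shared vertices are assigned to
  \<open>A\<close>.\<close>

lemma touching_paths:
  assumes sym: "symp E" and cA: "centred E A r a" and cB: "centred E B r b" and b: "b \<notin> A"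
    and touch: "\<exists>x\<in>A. \<exists>y\<in>B. x = y \<or> E x y"
  shows "\<exists>P Q. P \<subseteq> A \<and> Q \<subseteq> B \<and> finite P \<and> finite Q \<and> card P \<le> r + 1 \<and> card Q \<le> r + 1 \<and>
    centred E P r a \<and> centred E Q r b \<and> Q \<inter> A = {} \<and> (\<exists>x\<in>P. \<exists>y\<in>Q. E x y)"
proof -
  define near where "near n \<longleftrightarrow> (\<exists>y. reach E B n b y \<and> (\<exists>x\<in>A. x = y \<or> E x y))" for n
  have nr: "near r" using touch cB unfolding near_def centred_def by blast
  define n where "n = (LEAST n. near n)"
  have n: "near n" "n \<le> r" using LeastI[of near, OF nr] Least_le[of near, OF nr] by (auto simp: n_def)
  have least: "\<not> near m" if "m < n" for m using not_less_Least[of m near] that by (simp add: n_def)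
  have avoid: "z \<notin> A" if z: "reach E B n b z" for z
  proof
    assume "z \<in> A"
    show False
    proof (cases n)
      case 0
      then show False using z b \<open>z \<in> A\<close> by simp
    next
      case (Suc m)
      then have nm: "\<not> near m" using least by simp
      with \<open>z \<in> A\<close> have "\<not> reach E B m b z" unfolding near_def by blast
      then obtain w where "reach E B m b w" "E w z" using z Suc by auto
      then show False using nm \<open>z \<in> A\<close> sympD[OF sym] unfolding near_def by blast
    qed
  qed
  from n obtain x y where xy: "reach E B n b y" "x \<in> A" "x = y \<or> E x y" unfolding near_def by blast
  then have "E x y" using avoid by blast
  from reach_path[OF xy(1)] obtain Q where Q: "Q \<subseteq> B" "finite Q" "card Q \<le> n + 1" "y \<in> Q" "centred E Q n b"
    by blast
  have QA: "Q \<inter> A = {}"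
    using Q avoid by (auto simp: centred_def intro: reach_mono)
  have "centred E Q r b" using Q n(2) by (auto simp: centred_def intro: reach_mono)
  moreover have "reach E A r a x" using cA xy by (simp add: centred_def)
  from reach_path[OF this] obtain P where "P \<subseteq> A" "finite P" "card P \<le> r + 1" "x \<in> P" "centred E P r a"
    by blast
  ultimately show ?thesis using Q QA \<open>E x y\<close> n(2)
    by (intro exI[of _ P] exI[of _ Q]) auto
qed

text \<open>Among the sampled sets, a vertex is given to the sampled set of least index that contains it.\<close>

lemma congested_clique_bound:
  assumes exp: "expansion_bounded_by G f" and f: "f r \<ge> 0" and C: "C \<ge> 1"
    and sub: "\<And>i. i < h \<Longrightarrow> \<Phi> i \<subseteq> verts G"
    and cen: "\<And>i. i < h \<Longrightarrow> centred (adj G) (\<Phi> i) r (c i)"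
    and unc: "\<And>i j. i < h \<Longrightarrow> j < h \<Longrightarrow> i \<noteq> j \<Longrightarrow> c i \<notin> \<Phi> j"
    and touch: "\<And>i j. i < h \<Longrightarrow> j < h \<Longrightarrow> i \<noteq> j \<Longrightarrow> \<exists>x\<in>\<Phi> i. \<exists>y\<in>\<Phi> j. x = y \<or> adj G x y"
    and cong: "\<And>v. v \<in> verts G \<Longrightarrow> card {i. i < h \<and> v \<in> \<Phi> i} \<le> C"
  shows "real h \<le> 8 * real (C * (2 * r + 2)) * f r + 1"
proof -
  have "\<exists>P Q. P \<subseteq> \<Phi> i \<and> Q \<subseteq> \<Phi> j \<and> finite P \<and> finite Q \<and> card P \<le> r + 1 \<and> card Q \<le> r + 1 \<and>
    centred (adj G) P r (c i) \<and> centred (adj G) Q r (c j) \<and> Q \<inter> \<Phi> i = {} \<and> (\<exists>x\<in>P. \<exists>y\<in>Q. adj G x y)"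
    if "i < j" "j < h" for i j
    using that by (intro touching_paths symp_adj cen unc touch) auto
  then obtain P Q where PQ: "\<And>i j. i < j \<Longrightarrow> j < h \<Longrightarrow> P i j \<subseteq> \<Phi> i \<and> Q i j \<subseteq> \<Phi> j \<and>
    finite (P i j) \<and> finite (Q i j) \<and> card (P i j) \<le> r + 1 \<and> card (Q i j) \<le> r + 1 \<and>
    centred (adj G) (P i j) r (c i) \<and> centred (adj G) (Q i j) r (c j) \<and> Q i j \<inter> \<Phi> i = {} \<and>
    (\<exists>x\<in>P i j. \<exists>y\<in>Q i j. adj G x y)" by metis
  \<comment> \<open>These are the indices, other than \<open>i\<close> and \<open>j\<close>, that
    could take vertices of the two walks away.\<close>
  define L where "L i j = {l. l < h \<and> l \<noteq> i \<and> l \<noteq> j \<and> \<Phi> l \<inter> (P i j \<union> Q i j) \<noteq> {}}" for i j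
  show ?thesis
  proof (rule sampling_bound[of "C * (2 * r + 2)" "f r" h L])
    show "1 \<le> C * (2 * r + 2)" "0 \<le> f r" using C f by auto
    show "L i j \<subseteq> {..<h} - {i, j}" for i j by (auto simp: L_def)
    show "card (L i j) \<le> C * (2 * r + 2)" if ij: "i < j" "j < h" for i j
    proof -
      let ?W = "P i j \<union> Q i j"
      have W: "finite ?W" "?W \<subseteq> verts G" using PQ[OF ij] sub[of i] sub[of j] ij by auto
      have "L i j \<subseteq> (\<Union>v\<in>?W. {l. l < h \<and> v \<in> \<Phi> l})" by (auto simp: L_def)
      then have "card (L i j) \<le> card (\<Union>v\<in>?W. {l. l < h \<and> v \<in> \<Phi> l})"
        using W by (intro card_mono) auto
      also have "\<dots> \<le> (\<Sum>v\<in>?W. card {l. l < h \<and> v \<in> \<Phi> l})" using W by (intro card_UN_le)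
      also have "\<dots> \<le> card ?W * C"
        using sum_bounded_above[of ?W "\<lambda>v. card {l. l < h \<and> v \<in> \<Phi> l}" C] cong W by auto
      also have "card ?W \<le> 2 * r + 2" using card_Un_le[of "P i j" "Q i j"] PQ[OF ij] by linarith
      finally show ?thesis by (simp add: mult.commute)
    qed
    fix J assume J: "J \<subseteq> {..<h}"
    define own where "own i = {u \<in> \<Phi> i. \<forall>l\<in>J. l < i \<longrightarrow> u \<notin> \<Phi> l}" for i
    \<comment> \<open>\<open>own i\<close> may be disconnected. The part kept is the ball around
      \<open>c i\<close>; it contains the chosen walks of the pairs whose conflicting indices are
      not sampled.\<close>
    define \<Psi> where "\<Psi> i = {v. reach (adj G) (own i) r (c i) v}" for i
    define D where "D = {(i, j). i < j \<and> i \<in> J \<and> j \<in> J \<and> L i j \<inter> J = {}}"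
    have \<Psi>own: "\<Psi> i \<subseteq> own i" for i using reach_in by (fastforce simp: \<Psi>_def)
    have "real (card ((\<lambda>(i, j). {i, j}) ` D)) \<le> f r * real (card J)"
    proof (rule minor_edges_le[OF exp, where \<Phi> = \<Psi> and c = c])
      show "finite J" using J finite_subset by blast
      show "\<Psi> i \<subseteq> verts G" if "i \<in> J" for i
        using \<Psi>own[of i] sub[of i] J that by (auto simp: own_def)
      show "centred (adj G) (\<Psi> i) r (c i)" if "i \<in> J" for i
        unfolding \<Psi>_def
      proof (rule centred_ball)
        have "i < h" using that J by auto
        then show "c i \<in> own i" using cen[of i] unc[of i] J by (auto simp: own_def centred_def)
      qed
      show "\<Psi> i \<inter> \<Psi> j = {}" if "i \<in> J" "j \<in> J" "i \<noteq> j" for i j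
      proof -
        have "own i \<inter> own j = {}" using that by (auto simp: own_def)
        then show ?thesis using \<Psi>own by blast
      qed
      fix e assume "e \<in> (\<lambda>(i, j). {i, j}) ` D"
      then obtain i j where ij: "i < j" "i \<in> J" "j \<in> J" "L i j \<inter> J = {}" "e = {i, j}"
        by (auto simp: D_def)
      then have jh: "j < h" using J by auto
      note pq = PQ[OF ij(1) jh]
      have noL: "u \<notin> \<Phi> l" if "u \<in> P i j \<union> Q i j" "l \<in> J" "l \<noteq> i" "l \<noteq> j" for u l
        using that ij(4) J by (auto simp: L_def)
      have "P i j \<subseteq> own i" using pq noL ij(1) by (auto simp: own_def)
      then have "P i j \<subseteq> \<Psi> i" using pq by (auto simp: \<Psi>_def centred_def intro: reach_mono)
      \<comment> \<open>\<open>noL\<close> leaves only \<open>l = i\<close>, and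
        \<open>Q i j\<close> avoids \<open>\<Phi> i\<close> by its choice. For \<open>P i j\<close>
        this case does not arise, since there \<open>l < i\<close>.\<close>
      moreover have "u \<notin> \<Phi> l" if "u \<in> Q i j" "l \<in> J" "l < j" for u l
        using noL[of u l] that pq by (cases "l = i") auto
      then have "Q i j \<subseteq> own j" using pq by (auto simp: own_def)
      then have "Q i j \<subseteq> \<Psi> j" using pq by (auto simp: \<Psi>_def centred_def intro: reach_mono)
      ultimately have "\<exists>x\<in>\<Psi> i. \<exists>y\<in>\<Psi> j. adj G x y" using pq by blast
      then show "\<exists>i\<in>J. \<exists>j\<in>J. e = {i, j} \<and> i \<noteq> j \<and> (\<exists>x\<in>\<Psi> i. \<exists>y\<in>\<Psi> j. adj G x y)"
        using ij by (intro bexI[of _ i] bexI[of _ j]) auto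
    qed
    moreover have "inj_on (\<lambda>(i, j). {i, j}) D"
      by (auto simp: inj_on_def D_def doubleton_eq_iff)
    ultimately show "real (card {(i, j). i < j \<and> i \<in> J \<and> j \<in> J \<and> L i j \<inter> J = {}}) \<le> f r * real (card J)"
      by (simp add: card_image flip: D_def)
  qed
qed

section \<open>Closure of a vertex set\<close>

text \<open>Take a largest family of disjoint small connected sets each of which sees at least \<open>\<xi>\<close> of
  the other parts; the density of the minor they form bounds their number by \<open>card A\<close>.\<close>

lemma closure_exists:
  assumes G: "is_graph G" and exp: "expansion_bounded_by G f" and \<xi>: "2 * f D \<le> real \<xi>" "\<xi> \<ge> 1"
    and A: "A \<subseteq> verts G"
  shows "\<exists>A'. A \<subseteq> A' \<and> A' \<subseteq> verts G \<and> card A' \<le> (1 + \<xi> * (D + 1)) * card A \<and>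
    (\<forall>v\<in>verts G - A'. card {w \<in> A'. \<exists>u. reach (adj G) (verts G - A') D v u \<and> adj G u w} \<le> \<xi> * (\<xi> * (D + 1)))"
proof -
  define m where "m = \<xi> * (D + 1)"
  have m1: "m \<ge> 1" using \<xi> by (simp add: m_def)
  have finV: "finite (verts G)" using G by (simp add: is_graph_def)
  have finA: "finite A" using A finV finite_subset by blast
  define nodes where "nodes \<T> = (\<lambda>a. {a}) ` A \<union> \<T>" for \<T> :: "'a set set"
  \<comment> \<open>\<open>\<E>\<close> holds exactly \<open>\<xi>\<close> edges per member of
    \<open>\<T>\<close>, in the minor with branch sets \<open>nodes \<T>\<close>. Its density is at
    most \<open>f D\<close>, hence at most \<open>\<xi> / 2\<close>, so
    \<open>\<xi> * card \<T> \<le> \<xi> / 2 * (card A + card \<T>)\<close> and thus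
    \<open>card \<T> \<le> card A\<close>.\<close>
  define state where "state \<T> \<E> \<longleftrightarrow> finite \<T> \<and>
    (\<forall>T\<in>\<T>. T \<subseteq> verts G - A \<and> card T \<le> m \<and> (\<exists>c. centred (adj G) T D c)) \<and>
    (\<forall>S\<in>\<T>. \<forall>T\<in>\<T>. S \<noteq> T \<longrightarrow> S \<inter> T = {}) \<and>
    finite \<E> \<and> card \<E> = \<xi> * card \<T> \<and>
    (\<forall>e\<in>\<E>. \<exists>P\<in>nodes \<T>. \<exists>Q\<in>nodes \<T>. e = {P, Q} \<and> P \<noteq> Q \<and> (\<exists>x\<in>P. \<exists>y\<in>Q. adj G x y))" for \<T> \<E>
  have bound: "card \<T> \<le> card A" if st: "state \<T> \<E>" for \<T> \<E>
  proof -
    note st' = st[unfolded state_def]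
    note fT = st'[THEN conjunct1] and parts = bspec[OF st'[THEN conjunct2, THEN conjunct1]]
    note st'' = st'[THEN conjunct2, THEN conjunct2]
    note dis = st''[THEN conjunct1, rule_format] and cE = st''[THEN conjunct2, THEN conjunct2, THEN conjunct1]
      and edg = bspec[OF st''[THEN conjunct2, THEN conjunct2, THEN conjunct2]]
    have "centred (adj G) {a} D a" for a by (simp add: centred_def reach_refl)
    then have "\<exists>c. centred (adj G) P D c" if "P \<in> nodes \<T>" for P
      using that parts[of P] by (auto simp: nodes_def)
    then obtain c where c: "\<And>P. P \<in> nodes \<T> \<Longrightarrow> centred (adj G) P D (c P)" by metis
    have "real (card \<E>) \<le> f D * real (card (nodes \<T>))"
    proof (rule minor_edges_le[OF exp, where \<Phi> = "\<lambda>P. P" and c = c])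
      show "finite (nodes \<T>)" using finA fT by (simp add: nodes_def)
      show "P \<subseteq> verts G" if "P \<in> nodes \<T>" for P using that parts[of P] A by (auto simp: nodes_def)
      show "centred (adj G) P D (c P)" if "P \<in> nodes \<T>" for P using c that .
      show "P \<inter> Q = {}" if "P \<in> nodes \<T>" "Q \<in> nodes \<T>" "P \<noteq> Q" for P Q
        using that dis[of P Q] parts[of P] parts[of Q] by (auto simp: nodes_def)
      show "\<exists>P\<in>nodes \<T>. \<exists>Q\<in>nodes \<T>. e = {P, Q} \<and> P \<noteq> Q \<and> (\<exists>x\<in>P. \<exists>y\<in>Q. adj G x y)" if "e \<in> \<E>" for e
        using edg[OF that] .
    qed
    also have "\<dots> \<le> real \<xi> / 2 * real (card (nodes \<T>))" using \<xi> by (intro mult_right_mono) auto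
    also have "\<dots> \<le> real \<xi> / 2 * (real (card A) + real (card \<T>))"
    proof (intro mult_left_mono)
      have "card (nodes \<T>) \<le> card A + card \<T>"
        using card_Un_le[of "(\<lambda>a. {a}) ` A" \<T>] card_image_le[OF finA, of "\<lambda>a. {a}"]
        by (simp add: nodes_def)
      then show "real (card (nodes \<T>)) \<le> real (card A) + real (card \<T>)" by linarith
    qed auto
    finally have "real \<xi> * real (card \<T>) \<le> real \<xi> * real (card A)"
      using cE by (simp add: algebra_simps)
    then show ?thesis using \<xi> by simp
  qed
  have "state {} {}" by (simp add: state_def)
  then have "\<exists>p. (\<lambda>(\<T>, \<E>). state \<T> \<E>) p \<and>
      (\<forall>q. (\<lambda>(\<T>, \<E>). state \<T> \<E>) q \<longrightarrow> (card \<circ> fst) q \<le> (card \<circ> fst) p)"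
    by (intro ex_has_greatest_nat[where b = "Suc (card A)" and k = "({}, {})"]) (auto simp: less_Suc_eq_le intro: bound)
  then obtain \<T> \<E> where st: "state \<T> \<E>" and max: "\<And>\<T>' \<E>'. state \<T>' \<E>' \<Longrightarrow> card \<T>' \<le> card \<T>"
    by (auto simp: split_def)
  note st' = st[unfolded state_def]
  note fT = st'[THEN conjunct1] and parts = bspec[OF st'[THEN conjunct2, THEN conjunct1]]
  note st'' = st'[THEN conjunct2, THEN conjunct2]
  note dis = st''[THEN conjunct1, rule_format] and finE = st''[THEN conjunct2, THEN conjunct1]
    and cE = st''[THEN conjunct2, THEN conjunct2, THEN conjunct1]
    and edg = bspec[OF st''[THEN conjunct2, THEN conjunct2, THEN conjunct2]]
  define A' where "A' = A \<union> \<Union>\<T>"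
  have A'nodes: "A' = \<Union>(nodes \<T>)" by (auto simp: A'_def nodes_def)
  have A'V: "A' \<subseteq> verts G" using A parts unfolding A'_def by blast
  have cA': "card A' \<le> (1 + m) * card A"
  proof -
    have "card (\<Union>\<T>) \<le> (\<Sum>T\<in>\<T>. card T)" by (rule card_Union_le_sum_card)
    also have "\<dots> \<le> card \<T> * m" using sum_bounded_above[of \<T> card m] parts by simp
    also have "\<dots> \<le> card A * m" using bound[OF st] by (rule mult_le_mono1)
    finally show ?thesis using card_Un_le[of A "\<Union>\<T>"] by (simp add: A'_def algebra_simps)
  qed
  \<comment> \<open>Each part has at most \<open>m\<close> vertices, so more than
    \<open>\<xi> * m\<close> visible vertices meet at least \<open>\<xi>\<close> parts. The union
    \<open>T\<close> of short walks from \<open>v\<close> towards \<open>\<xi>\<close> of them would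
    extend the family, against its maximality.\<close>
  have "card {w \<in> A'. \<exists>u. reach (adj G) (verts G - A') D v u \<and> adj G u w} \<le> \<xi> * m" (is "card ?N \<le> _")
    if v: "v \<in> verts G - A'" for v
  proof (rule ccontr)
    assume big: "\<not> card ?N \<le> \<xi> * m"
    define \<H> where "\<H> = {P \<in> nodes \<T>. P \<inter> ?N \<noteq> {}}"
    have fn: "finite (nodes \<T>)" using finA fT by (simp add: nodes_def)
    then have fH: "finite \<H>" by (simp add: \<H>_def)
    have cn: "card P \<le> m \<and> finite P" if "P \<in> nodes \<T>" for P
    proof -
      have "P \<subseteq> verts G" using that A'V A'nodes by blast
      then show ?thesis using that parts[of P] m1 finV finite_subset by (auto simp: nodes_def)
    qed
    have "?N \<subseteq> \<Union>\<H>" unfolding A'nodes \<H>_def by blast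
    then have "card ?N \<le> card (\<Union>\<H>)" using fH cn by (intro card_mono) (auto simp: \<H>_def)
    also have "\<dots> \<le> (\<Sum>P\<in>\<H>. card P)" by (rule card_Union_le_sum_card)
    also have "\<dots> \<le> card \<H> * m"
      using sum_bounded_above[of \<H> card m] cn by (simp add: \<H>_def)
    finally have "\<xi> * m < card \<H> * m" using big by linarith
    then have "\<xi> \<le> card \<H>" by simp
    then obtain \<H>' where H': "\<H>' \<subseteq> \<H>" "card \<H>' = \<xi>" "finite \<H>'"
      using obtain_subset_with_card_n by metis
    have "\<forall>P\<in>\<H>'. \<exists>Q w. w \<in> P \<and> Q \<subseteq> verts G - A' \<and> finite Q \<and> card Q \<le> D + 1 \<and>
        centred (adj G) Q D v \<and> (\<exists>u\<in>Q. adj G u w)"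
    proof
      fix P assume "P \<in> \<H>'"
      then have "P \<in> \<H>" using H' by blast
      then have "P \<inter> ?N \<noteq> {}" unfolding \<H>_def by blast
      then obtain w u where "w \<in> P" "reach (adj G) (verts G - A') D v u" "adj G u w" by blast
      with reach_path[of "adj G" "verts G - A'" D v u] show "\<exists>Q w. w \<in> P \<and> Q \<subseteq> verts G - A' \<and> finite Q \<and> card Q \<le> D + 1 \<and>
        centred (adj G) Q D v \<and> (\<exists>u\<in>Q. adj G u w)" by blast
    qed
    then obtain Q w where Q: "\<And>P. P \<in> \<H>' \<Longrightarrow> w P \<in> P \<and> Q P \<subseteq> verts G - A' \<and> finite (Q P) \<and>
        card (Q P) \<le> D + 1 \<and> centred (adj G) (Q P) D v \<and> (\<exists>u\<in>Q P. adj G u (w P))" by metis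
    define T where "T = \<Union>(Q ` \<H>')"
    have ne: "\<H>' \<noteq> {}" using H' \<xi> by auto
    have cT: "centred (adj G) T D v" unfolding T_def using ne Q by (intro centred_Union) auto
    then have vT: "v \<in> T" by (simp add: centred_def)
    have TV: "T \<subseteq> verts G - A'" using Q by (auto simp: T_def)
    have "card T \<le> (\<Sum>P\<in>\<H>'. card (Q P))" unfolding T_def using H' by (intro card_UN_le)
    also have "\<dots> \<le> \<xi> * (D + 1)"
      using sum_bounded_above[of \<H>' "\<lambda>P. card (Q P)" "D + 1"] Q H' by simp
    finally have Tm: "card T \<le> m" by (simp add: m_def)
    have Tn: "T \<notin> nodes \<T>" using vT v A'nodes by blast
    have Hn: "\<H>' \<subseteq> nodes \<T>" using H' by (auto simp: \<H>_def)
    define \<E>' where "\<E>' = \<E> \<union> (\<lambda>P. {T, P}) ` \<H>'"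
    have "e \<subseteq> nodes \<T>" if "e \<in> \<E>" for e using edg[OF that] by blast
    then have disE: "\<E> \<inter> (\<lambda>P. {T, P}) ` \<H>' = {}" using Tn by blast
    have "inj_on (\<lambda>P. {T, P}) \<H>'" by (auto simp: inj_on_def doubleton_eq_iff)
    then have "card \<E>' = \<xi> * card \<T> + \<xi>"
      unfolding \<E>'_def using finE H' disE cE by (subst card_Un_disjoint) (auto simp: card_image)
    moreover have TT: "T \<notin> \<T>" using Tn by (simp add: nodes_def)
    ultimately have cE': "card \<E>' = \<xi> * card (insert T \<T>)" using fT by simp
    have nI: "nodes (insert T \<T>) = insert T (nodes \<T>)" by (simp add: nodes_def)
    have "state (insert T \<T>) \<E>'" unfolding state_def
    proof (intro conjI ballI impI)
      show "finite (insert T \<T>)" "finite \<E>'" using fT finE H' by (auto simp: \<E>'_def)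
      show "S \<subseteq> verts G - A" "card S \<le> m" "\<exists>c. centred (adj G) S D c" if "S \<in> insert T \<T>" for S
        using that parts[of S] TV Tm cT by (auto simp: A'_def)
      show "S \<inter> S' = {}" if "S \<in> insert T \<T>" "S' \<in> insert T \<T>" "S \<noteq> S'" for S S'
        using that dis[of S S'] TV by (auto simp: A'_def)
      show "card \<E>' = \<xi> * card (insert T \<T>)" by fact
      fix e assume "e \<in> \<E>'"
      then consider "e \<in> \<E>" | P where "P \<in> \<H>'" "e = {T, P}" by (auto simp: \<E>'_def)
      then show "\<exists>P\<in>nodes (insert T \<T>). \<exists>Q\<in>nodes (insert T \<T>). e = {P, Q} \<and> P \<noteq> Q \<and> (\<exists>x\<in>P. \<exists>y\<in>Q. adj G x y)"
      proof cases
        case 1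
        then show ?thesis using edg[of e] unfolding nI by blast
      next
        case 2
        have "\<exists>x\<in>T. \<exists>y\<in>P. adj G x y" using Q[OF 2(1)] 2(1) by (auto simp: T_def)
        moreover have "P \<in> nodes \<T>" "T \<noteq> P" using 2(1) Hn Tn by auto
        ultimately show ?thesis unfolding nI using 2(2)
          by (intro bexI[of _ T] bexI[of _ P] conjI insertI1 insertI2)
      qed
    qed
    from max[OF this] show False using TT fT by simp
  qed
  then show ?thesis using A'V cA' by (intro exI[of _ A']) (auto simp: A'_def m_def)
qed

section \<open>The overlay graph\<close>

text \<open>\<open>w\<close> is the only vertex of \<open>A\<close> in its cell when
  \<open>w\<close> lies in \<open>A\<close>, so such cells overlap only outside \<open>A\<close>,
  where the closure controls the overlap. \<open>D\<close> counts the steps after the one that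
  leaves \<open>w\<close>.\<close>

definition cell :: "'a graph \<Rightarrow> 'a set \<Rightarrow> nat \<Rightarrow> 'a \<Rightarrow> 'a set" where
  "cell G A D w = insert w {u. \<exists>u0. adj G w u0 \<and> reach (adj G) (verts G - A) D u0 u}"

definition overlay :: "'a graph \<Rightarrow> 'a set \<Rightarrow> nat \<Rightarrow> 'a \<Rightarrow> 'a \<Rightarrow> bool" where
  "overlay G A D w w' \<longleftrightarrow> w \<in> A \<and> w' \<in> A \<and> (\<exists>u\<in>cell G A D w. \<exists>u'\<in>cell G A D w'. u = u' \<or> adj G u u')"

lemma symp_overlay: "symp (overlay G A D)"
  unfolding symp_def overlay_def by (metis insert_commute)

lemma self_in_cell: "w \<in> cell G A D w"
  by (simp add: cell_def)

lemma cell_outside: "u \<in> cell G A D w \<Longrightarrow> u \<noteq> w \<Longrightarrow> u \<in> verts G - A"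
  using reach_in by (fastforce simp: cell_def)

lemma centred_cell: "centred (adj G) (cell G A D w) (Suc D) w"
  unfolding centred_def
proof (intro conjI ballI self_in_cell)
  fix u assume u: "u \<in> cell G A D w"
  show "reach (adj G) (cell G A D w) (Suc D) w u"
  proof (cases "u = w")
    case True
    then show ?thesis by (simp only: reach_refl[OF self_in_cell])
  next
    case False
    then obtain u0 where u0: "adj G w u0" "reach (adj G) (verts G - A) D u0 u"
      using u by (auto simp: cell_def)
    from reach_path[OF u0(2)] obtain P where P: "P \<subseteq> verts G - A" "u \<in> P" "centred (adj G) P D u0" by blast
    have "P \<subseteq> cell G A D w"
      using P u0(1) by (auto simp: cell_def centred_def intro: reach_mono)
    moreover from this have "reach (adj G) (cell G A D w) 1 w u0"
      using u0(1) P(3) self_in_cell[of w G A D] by (intro reach_step) (auto simp: centred_def)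
    moreover have "reach (adj G) P D u0 u" using P by (simp add: centred_def)
    ultimately have "reach (adj G) (cell G A D w) (1 + D) w u"
      by (meson order_refl reach_mono reach_trans)
    then show ?thesis by simp
  qed
qed

text \<open>\<open>w\<close> is the last vertex of \<open>A\<close> met so far, and the walk since
  then avoids \<open>A\<close>. When it returns to \<open>A\<close> at \<open>v\<close>, the vertex
  before \<open>v\<close> lies in the cell of \<open>w\<close>, so \<open>w\<close> and
  \<open>v\<close> are joined in the overlay. Recording \<open>b \<in> Z\<close> lets the exchange
  argument exclude the boundary from this walk.\<close>

lemma overlay_walk:
  assumes "reach (adj G) Z k x v" "k \<le> D" "Z \<subseteq> verts G" "x \<in> A"
  shows "\<exists>w. (\<lambda>a b. overlay G A D a b \<and> b \<in> Z)\<^sup>*\<^sup>* x w \<and> w \<in> A \<and>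
    (v = w \<or> v \<notin> A \<and> (\<exists>u0. adj G w u0 \<and> reach (adj G) (verts G - A) k u0 v))"
  using assms(1,2)
proof (induction k arbitrary: v)
  case 0
  then show ?case using assms by auto
next
  case (Suc k)
  show ?case
  proof (cases "reach (adj G) Z k x v")
    case True
    then show ?thesis using Suc.IH[of v] Suc.prems by auto
  next
    case False
    then obtain u where u: "reach (adj G) Z k x u" "adj G u v" "v \<in> Z" using Suc.prems by auto
    obtain w where w: "(\<lambda>a b. overlay G A D a b \<and> b \<in> Z)\<^sup>*\<^sup>* x w" "w \<in> A"
      "u = w \<or> u \<notin> A \<and> (\<exists>u0. adj G w u0 \<and> reach (adj G) (verts G - A) k u0 u)"
      using Suc.IH[OF u(1)] Suc.prems by auto
    show ?thesis
    proof (cases "v \<in> A")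
      case True
      have "u \<in> cell G A D w"
      proof (cases "u = w")
        case False
        then obtain u0 where u0: "adj G w u0" "reach (adj G) (verts G - A) k u0 u" using w(3) by blast
        have "reach (adj G) (verts G - A) D u0 u"
          using Suc.prems(2) by (intro reach_mono[OF u0(2)]) auto
        then show ?thesis using u0(1) by (auto simp: cell_def)
      qed (simp add: self_in_cell)
      then have "overlay G A D w v"
        using True w(2) u(2) self_in_cell unfolding overlay_def by metis
      then have "(\<lambda>a b. overlay G A D a b \<and> b \<in> Z)\<^sup>*\<^sup>* x v"
        using u(3) by (intro rtranclp.rtrancl_into_rtrancl[OF w(1)]) simp
      then show ?thesis using True by (intro exI[of _ v]) simp
    next
      case False
      have v: "v \<in> verts G - A" using u(3) assms False by auto
      have "\<exists>u0. adj G w u0 \<and> reach (adj G) (verts G - A) (Suc k) u0 v"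
      proof (cases "u = w")
        case True
        then show ?thesis using u(2) reach_refl[OF v] by blast
      next
        case False
        then show ?thesis using w(3) u(2) v by auto
      qed
      then show ?thesis using w False by blast
    qed
  qed
qed

text \<open>The unions of cells over the branch sets have congestion at most \<open>C\<close>: as
  branch sets are disjoint, those whose union contains \<open>v\<close> supply different
  \<open>w\<close> with \<open>v\<close> in the cell of \<open>w\<close>, and the closure bounds the
  number of these. One overlay step costs \<open>(D + 1) + 1 + (D + 1)\<close> steps in
  \<open>G\<close>, and the last cell adds \<open>D + 1\<close>; this is the origin of
  \<open>r\<close>.\<close>

lemma overlay_clique_model_bound:
  assumes G: "is_graph G" and exp: "expansion_bounded_by G f" and f: "\<And>r. f r \<ge> 0" and C: "C \<ge> 1"
    and A: "A \<subseteq> verts G"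
    and closed: "\<And>v. v \<in> verts G - A \<Longrightarrow>
      card {w \<in> A. \<exists>u. reach (adj G) (verts G - A) D v u \<and> adj G u w} \<le> C"
    and cm: "clique_model (overlay G A D) A R \<M>"
    and r: "r = R * (2 * D + 3) + (D + 1)"
  shows "real (card \<M>) \<le> 8 * real (C * (2 * r + 2)) * f r + 1"
proof -
  have finV: "finite (verts G)" using G by (simp add: is_graph_def)
  have finA: "finite A" using A finV finite_subset by blast
  have finM: "finite \<M>"
    and MA: "\<And>M. M \<in> \<M> \<Longrightarrow> M \<subseteq> A" and Mc: "\<And>M. M \<in> \<M> \<Longrightarrow> \<exists>c. centred (overlay G A D) M R c"
    and Mdis: "\<And>M N. M \<in> \<M> \<Longrightarrow> N \<in> \<M> \<Longrightarrow> M \<noteq> N \<Longrightarrow> M \<inter> N = {}"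
    and Madj: "\<And>M N. M \<in> \<M> \<Longrightarrow> N \<in> \<M> \<Longrightarrow> M \<noteq> N \<Longrightarrow> \<exists>x\<in>M. \<exists>y\<in>N. overlay G A D x y"
    using cm unfolding clique_model_def by blast+
  obtain c where c: "\<And>M. M \<in> \<M> \<Longrightarrow> centred (overlay G A D) M R (c M)" using Mc by metis
  have cM: "c M \<in> M" if "M \<in> \<M>" for M using c[OF that] by (simp add: centred_def)
  obtain e where e: "bij_betw e {..<card \<M>} \<M>"
    using ex_bij_betw_nat_finite[OF finM] by (auto simp: atLeast0LessThan)
  have eM: "e i \<in> \<M>" if "i < card \<M>" for i using e that by (auto simp: bij_betw_def)
  have einj: "e i \<noteq> e j" if "i < card \<M>" "j < card \<M>" "i \<noteq> j" for i j
    using e that by (auto simp: bij_betw_def inj_on_def)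
  define U where "U M = (\<Union>w\<in>M. cell G A D w)" for M
  have cellU: "w \<in> M \<Longrightarrow> cell G A D w \<subseteq> U M" for w M by (auto simp: U_def)
  have UA: "a \<in> M" if "a \<in> U M" "a \<in> A" for a M
    using that cell_outside[of a G A D] by (auto simp: U_def)
  have UV: "U M \<subseteq> verts G" if "M \<in> \<M>" for M
    using MA[OF that] A cell_outside[of _ G A D] by (fastforce simp: U_def)
  have walk: "reach (adj G) (U M) (k * (2 * D + 3)) a w"
    if "reach (overlay G A D) M k a w" "M \<in> \<M>" for M k a w
    using that(1)
  proof (induction k arbitrary: w)
    case 0
    then show ?case using cellU[of w M] self_in_cell[of w G A D] by auto
  next
    case (Suc k)
    show ?case
    proof (cases "reach (overlay G A D) M k a w")
      case True
      then show ?thesis by (intro reach_mono[OF Suc.IH]) auto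
    next
      case False
      then obtain w' where w': "reach (overlay G A D) M k a w'" "overlay G A D w' w" "w \<in> M"
        using Suc.prems by auto
      have "w' \<in> M" using reach_in[OF w'(1)] by simp
      obtain u u' where u: "u \<in> cell G A D w'" "u' \<in> cell G A D w" "u = u' \<or> adj G u u'"
        using w'(2) unfolding overlay_def by blast
      have "reach (adj G) (U M) (Suc D) w' u"
        using centred_cell[of G A D w'] u(1) cellU[OF \<open>w' \<in> M\<close>]
        by (auto simp: centred_def simp del: reach.simps intro: reach_mono)
      moreover have "reach (adj G) (U M) 1 u u'"
        using u cellU[OF \<open>w' \<in> M\<close>] cellU[OF w'(3)] by (auto intro: reach_refl)
      moreover have "reach (adj G) (U M) (Suc D) w u'"
        using centred_cell[of G A D w] u(2) cellU[OF w'(3)]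
        by (auto simp: centred_def simp del: reach.simps intro: reach_mono)
      then have "reach (adj G) (U M) (Suc D) u' w" by (rule reach_sym[OF symp_adj])
      ultimately have "reach (adj G) (U M) (k * (2 * D + 3) + (Suc D + (1 + Suc D))) a w"
        using Suc.IH[OF w'(1)] by (meson reach_trans)
      then show ?thesis by (rule reach_mono) auto
    qed
  qed
  show ?thesis
  proof (rule congested_clique_bound[OF exp f C, where \<Phi> = "\<lambda>i. U (e i)" and c = "\<lambda>i. c (e i)"])
    show "U (e i) \<subseteq> verts G" if "i < card \<M>" for i using UV eM that .
    show "centred (adj G) (U (e i)) r (c (e i))" if "i < card \<M>" for i
      unfolding centred_def
    proof (intro conjI ballI)
      note M = eM[OF that]
      show "c (e i) \<in> U (e i)" using cellU[OF cM[OF M]] self_in_cell[of "c (e i)" G A D] by (rule subsetD)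
      fix x assume "x \<in> U (e i)"
      then obtain w where w: "w \<in> e i" "x \<in> cell G A D w" by (auto simp: U_def)
      have "reach (overlay G A D) (e i) R (c (e i)) w" using c[OF M] w by (simp add: centred_def)
      then have "reach (adj G) (U (e i)) (R * (2 * D + 3)) (c (e i)) w" using M by (rule walk)
      moreover have "reach (adj G) (U (e i)) (D + 1) w x"
        using centred_cell[of G A D w] w(2) cellU[OF w(1)]
        by (auto simp: centred_def simp del: reach.simps intro: reach_mono)
      ultimately show "reach (adj G) (U (e i)) r (c (e i)) x" unfolding r by (rule reach_trans)
    qed
    show "c (e i) \<notin> U (e j)" if "i < card \<M>" "j < card \<M>" "i \<noteq> j" for i j
      using UA[of "c (e i)" "e j"] cM[OF eM[OF that(1)]] MA[OF eM[OF that(1)]]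
        Mdis[OF eM[OF that(1)] eM[OF that(2)] einj[OF that]] by blast
    show "\<exists>x\<in>U (e i). \<exists>y\<in>U (e j). x = y \<or> adj G x y" if ij: "i < card \<M>" "j < card \<M>" "i \<noteq> j" for i j
    proof -
      obtain w w' where "w \<in> e i" "w' \<in> e j" "overlay G A D w w'"
        using Madj[OF eM[OF ij(1)] eM[OF ij(2)] einj[OF ij]] by blast
      then show ?thesis unfolding overlay_def U_def by blast
    qed
    show "card {i. i < card \<M> \<and> v \<in> U (e i)} \<le> C" if v: "v \<in> verts G" for v
    proof -
      define W where "W = {w \<in> A. v \<in> cell G A D w}"
      have finW: "finite W" using finA by (simp add: W_def)
      have "card W \<le> C"
      proof (cases "v \<in> A")
        case True
        then have "W \<subseteq> {v}" using cell_outside[of v G A D] by (auto simp: W_def)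
        then have "card W \<le> card {v}" by (intro card_mono) auto
        then show ?thesis using C by simp
      next
        case False
        have "W \<subseteq> {w \<in> A. \<exists>u. reach (adj G) (verts G - A) D v u \<and> adj G u w}"
          using False reach_sym[OF symp_adj] by (fastforce simp: W_def cell_def insert_commute)
        then have "card W \<le> card {w \<in> A. \<exists>u. reach (adj G) (verts G - A) D v u \<and> adj G u w}"
          using finA by (intro card_mono) auto
        then show ?thesis using closed[of v] v False by simp
      qed
      have "\<forall>i\<in>{i. i < card \<M> \<and> v \<in> U (e i)}. \<exists>w. w \<in> e i \<and> w \<in> W"
        using MA[OF eM] by (fastforce simp: U_def W_def)
      then obtain g where g: "\<And>i. i < card \<M> \<Longrightarrow> v \<in> U (e i) \<Longrightarrow> g i \<in> e i \<and> g i \<in> W" by auto metis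
      have "inj_on g {i. i < card \<M> \<and> v \<in> U (e i)}"
      proof (rule inj_onI, rule ccontr)
        fix i j assume "i \<in> {i. i < card \<M> \<and> v \<in> U (e i)}" "j \<in> {i. i < card \<M> \<and> v \<in> U (e i)}"
          "g i = g j" "i \<noteq> j"
        then show False using g[of i] g[of j] Mdis[OF eM eM einj, of i j] by auto
      qed
      then have "card {i. i < card \<M> \<and> v \<in> U (e i)} \<le> card W"
        using g finW by (intro card_inj_on_le[where f = g]) auto
      then show ?thesis using \<open>card W \<le> C\<close> by simp
    qed
  qed
qed

section \<open>Local search\<close>

text \<open>Pieces with between \<open>(4/3) ^ j\<close> and \<open>(4/3) ^ Suc j\<close> vertices are split by
  \<open>separation_or_clique_model\<close> with \<open>l = j\<^sup>2\<close>; the choice of \<open>d = j\<^sup>2 * Suc j\<close> gives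
  \<open>(1 + 1 / l) ^ d \<ge> 2 ^ Suc j\<close>.\<close>

definition ball_radius :: "nat \<Rightarrow> nat" where
  "ball_radius j = j\<^sup>2 * Suc j"

text \<open>\<open>2 * ball_radius j\<close> is the depth of the clique models met by the separator
  search; the rest converts overlay steps into steps of \<open>G\<close>.\<close>

definition minor_depth :: "nat \<Rightarrow> nat \<Rightarrow> nat" where
  "minor_depth D j = 2 * ball_radius j * (2 * D + 3) + (D + 1)"

text \<open>The summand 2 makes this strictly larger than the bound on overlay cliques, which ends
  in \<open>+ 1\<close>; hence no model has this size.\<close>

definition clique_size :: "(nat \<Rightarrow> real) \<Rightarrow> nat \<Rightarrow> nat \<Rightarrow> nat \<Rightarrow> nat" where
  "clique_size f C D j = nat \<lceil>8 * real (C * (2 * minor_depth D j + 2)) * f (minor_depth D j)\<rceil> + 2"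

lemma clique_size_bound:
  "f (minor_depth D j) \<ge> 0 \<Longrightarrow> real (clique_size f C D j) \<le> 8 * real (C * (2 * minor_depth D j + 2)) * f (minor_depth D j) + 3"
  "8 * real (C * (2 * minor_depth D j + 2)) * f (minor_depth D j) + 1 < real (clique_size f C D j)"
proof -
  let ?x = "8 * real (C * (2 * minor_depth D j + 2)) * f (minor_depth D j)"
  have cs: "real (clique_size f C D j) = real (nat \<lceil>?x\<rceil>) + 2" by (simp add: clique_size_def)
  have "?x \<le> real (nat \<lceil>?x\<rceil>)" by (rule real_nat_ceiling_ge)
  then show "?x + 1 < real (clique_size f C D j)" using cs by linarith
  assume "f (minor_depth D j) \<ge> 0"
  then have "?x \<ge> 0" by (intro mult_nonneg_nonneg) auto
  then have "real (nat \<lceil>?x\<rceil>) \<le> ?x + 1" by linarith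
  then show "real (clique_size f C D j) \<le> ?x + 3" using cs by linarith
qed

text \<open>Everything on the left is majorised by a polynomial in \<open>j\<close>, the clique size
  through \<open>p\<close> composed with the polynomial for the minor depth. The factor
  \<open>j\<^sup>2\<close> is there because the branch sets in a separator must fit into
  \<open>card U / j\<^sup>2\<close>.\<close>

lemma eventually_clique_size_small:
  fixes p :: "real poly"
  assumes p: "\<And>r::nat. poly p (real r) \<ge> 0"
  shows "\<forall>\<^sub>F j in sequentially. real (j\<^sup>2 * (clique_size (\<lambda>r. poly p (real r)) C D j *
    (clique_size (\<lambda>r. poly p (real r)) C D j * (2 * ball_radius j + 1)))) \<le> (4/3) ^ j"
proof -
  define X :: "real poly" where "X = [:0, 1:]"
  define d where "d = X\<^sup>2 * (1 + X)"
  define r where "r = smult (2 * real (2 * D + 3)) d + [:real (D + 1):]"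
  define q where "q = smult (8 * real C) ((smult 2 r + [:2:]) * pcompose p r) + [:3:]"
  have d: "poly d (real j) = real (ball_radius j)" for j
    by (simp add: d_def X_def ball_radius_def algebra_simps)
  have r: "poly r (real j) = real (minor_depth D j)" for j
    by (simp add: r_def d minor_depth_def)
  have q: "real (clique_size (\<lambda>r. poly p (real r)) C D j) \<le> poly q (real j)" for j
    using clique_size_bound(1)[of "\<lambda>r. poly p (real r)" D j C] p
    by (simp add: q_def r poly_pcompose algebra_simps)
  have "real (j\<^sup>2 * (clique_size (\<lambda>r. poly p (real r)) C D j *
      (clique_size (\<lambda>r. poly p (real r)) C D j * (2 * ball_radius j + 1))))
      \<le> poly (X\<^sup>2 * (q * (q * (smult 2 d + 1)))) (real j)" (is "?l j \<le> _") for j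
  proof -
    have "?l j = (real j)\<^sup>2 * (real (clique_size (\<lambda>r. poly p (real r)) C D j) *
      (real (clique_size (\<lambda>r. poly p (real r)) C D j) * (2 * real (ball_radius j) + 1)))"
      by (simp add: algebra_simps)
    also have "\<dots> \<le> (real j)\<^sup>2 * (poly q (real j) * (poly q (real j) * (2 * real (ball_radius j) + 1)))"
    proof -
      have "0 \<le> poly q (real j)" using q[of j] by linarith
      then show ?thesis using q[of j] by (intro mult_mono mult_nonneg_nonneg order_refl) auto
    qed
    finally show ?thesis by (simp add: X_def d)
  qed
  then show ?thesis
    using poly_eventually_le_power[of "4/3" "X\<^sup>2 * (q * (q * (smult 2 d + 1)))"]
    by (auto elim!: eventually_mono intro: order_trans)
qed

lemma overlay_division:
  assumes G: "is_graph G" and exp: "expansion_bounded_by G f" and f: "\<And>r. f r \<ge> 0" and C: "C \<ge> 1"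
    and A: "A \<subseteq> verts G"
    and closed: "\<And>v. v \<in> verts G - A \<Longrightarrow>
      card {w \<in> A. \<exists>u. reach (adj G) (verts G - A) D v u \<and> adj G u w} \<le> C"
    and \<epsilon>: "0 < \<epsilon>" "\<epsilon> \<le> 1" and J: "8 / \<epsilon> \<le> real J" "5 \<le> J"
    and small: "\<And>j. J \<le> j \<Longrightarrow>
      real (j\<^sup>2 * (clique_size f C D j * (clique_size f C D j * (2 * ball_radius j + 1)))) \<le> (4/3) ^ j"
  shows "\<exists>Ls. division (overlay G A D) A Ls \<and> (\<forall>L\<in>set Ls. real (card L) \<le> (4/3) ^ J) \<and>
    real (sum_list (map card Ls)) \<le> (1 + \<epsilon>) * real (card A)"
proof (rule division_exists[OF _ symp_overlay \<epsilon> J(1)])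
  show finA: "finite A" using A G finite_subset by (auto simp: is_graph_def)
  fix j U assume j: "J \<le> j" and U: "U \<subseteq> A" and lo: "(4/3) ^ j < real (card U)" and hi: "real (card U) \<le> (4/3) ^ Suc j"
  define h where "h = clique_size f C D j"
  define d where "d = ball_radius j"
  have j5: "5 \<le> j" using J j by simp
  then have jpos: "real (j\<^sup>2) > 0" by simp
  have "\<exists>B C. separation (overlay G A D) U B C \<and>
      real (card (B \<inter> C)) \<le> real (card U) / real (j\<^sup>2) + real (h * (h * (2 * d + 1))) \<and>
      real (card B) \<le> 2 * real (card U) / 3 + (real (card U) / real (j\<^sup>2) + real (h * (h * (2 * d + 1)))) \<and>
      real (card C) \<le> 2 * real (card U) / 3 + (real (card U) / real (j\<^sup>2) + real (h * (h * (2 * d + 1))))"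
  proof (rule separation_or_clique_model[OF _ symp_overlay jpos])
    show "finite U" using U finA finite_subset by blast
    show "1 \<le> h" by (simp add: h_def clique_size_def)
    have "0 \<le> 1 / real (j\<^sup>2)" by simp
    then have "-1 \<le> 1 / real (j\<^sup>2)" by linarith
    from Bernoulli_inequality[OF this, of "j\<^sup>2"]
    have "2 \<le> (1 + 1 / real (j\<^sup>2)) ^ j\<^sup>2" using jpos by simp
    then have "2 ^ Suc j \<le> ((1 + 1 / real (j\<^sup>2)) ^ j\<^sup>2) ^ Suc j" by (intro power_mono) auto
    also have "\<dots> = (1 + 1 / real (j\<^sup>2)) ^ d" by (simp only: d_def ball_radius_def power_mult)
    finally have "2 ^ Suc j \<le> (1 + 1 / real (j\<^sup>2)) ^ d" .
    moreover have "(4/3 :: real) ^ Suc j < 2 ^ Suc j" by (intro power_strict_mono) auto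
    ultimately show "real (card U) < (1 + 1 / real (j\<^sup>2)) ^ d" using hi by linarith
    fix \<M> assume "clique_model (overlay G A D) U (2 * d) \<M>"
    then have "clique_model (overlay G A D) A (2 * d) \<M>" using U unfolding clique_model_def by blast
    from overlay_clique_model_bound[OF G exp f C A closed this refl]
    have "real (card \<M>) \<le> 8 * real (C * (2 * minor_depth D j + 2)) * f (minor_depth D j) + 1"
      by (simp add: minor_depth_def d_def)
    then show "card \<M> \<noteq> h" using clique_size_bound(2)[of C D j f] by (auto simp: h_def)
  qed
  then obtain B C where BC: "separation (overlay G A D) U B C"
    "real (card (B \<inter> C)) \<le> real (card U) / real (j\<^sup>2) + real (h * (h * (2 * d + 1)))"
    "real (card B) \<le> 2 * real (card U) / 3 + (real (card U) / real (j\<^sup>2) + real (h * (h * (2 * d + 1))))"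
    "real (card C) \<le> 2 * real (card U) / 3 + (real (card U) / real (j\<^sup>2) + real (h * (h * (2 * d + 1))))"
    by blast
  \<comment> \<open>One share of \<open>card U / j\<^sup>2\<close> comes from
    \<open>l = j\<^sup>2\<close>, the other from \<open>small\<close>.\<close>
  moreover have "real (card U) / real (j\<^sup>2) + real (h * (h * (2 * d + 1))) \<le> 2 / (real j)\<^sup>2 * real (card U)"
  proof -
    have "real (j\<^sup>2) * real (h * (h * (2 * d + 1))) \<le> real (card U)"
      using small[OF j] lo unfolding h_def d_def of_nat_mult[symmetric] by linarith
    then have "real (h * (h * (2 * d + 1))) \<le> real (card U) / real (j\<^sup>2)"
      using jpos by (simp only: pos_le_divide_eq mult.commute)
    then show ?thesis by simp
  qed
  \<comment> \<open>This needs \<open>j \<ge> 5\<close>; then \<open>2/3 + 1/12 = 3/4\<close> is the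
    ratio required by the recursion.\<close>
  moreover have "2 / (real j)\<^sup>2 * real (card U) \<le> 1/12 * real (card U)"
  proof (intro mult_right_mono)
    have "5 * 5 \<le> real j * real j" using j5 by (intro mult_mono) auto
    then show "2 / (real j)\<^sup>2 \<le> 1/12" using jpos by (simp add: divide_le_eq power2_eq_square)
  qed simp
  ultimately show "\<exists>B C. separation (overlay G A D) U B C \<and> real (card (B \<inter> C)) \<le> 2 / (real j)\<^sup>2 * real (card U) \<and>
        real (card B) \<le> 3/4 * real (card U) \<and> real (card C) \<le> 3/4 * real (card U)"
    by (intro exI[of _ B] exI[of _ C] conjI) linarith+
qed

section \<open>Boundaries of pieces and local exchanges\<close>

text \<open>Taken by position: equal pieces at different positions consist entirely of
  boundary.\<close>

definition boundary :: "'a set list \<Rightarrow> nat \<Rightarrow> 'a set" where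
  "boundary Ls i = {v \<in> Ls ! i. \<exists>j<length Ls. j \<noteq> i \<and> v \<in> Ls ! j}"

lemma sum_card_swap:
  assumes "finite A" "finite I" "\<And>i. i \<in> I \<Longrightarrow> F i \<subseteq> A"
  shows "(\<Sum>i\<in>I. card (F i)) = (\<Sum>v\<in>A. card {i \<in> I. v \<in> F i})"
proof -
  have "(\<Sum>i\<in>I. card (F i)) = (\<Sum>i\<in>I. \<Sum>v\<in>A. of_bool (v \<in> F i))"
  proof (intro sum.cong refl)
    fix i assume "i \<in> I"
    then have "F i = A \<inter> {v. v \<in> F i}" using assms by auto
    then show "card (F i) = (\<Sum>v\<in>A. of_bool (v \<in> F i))" using assms by simp
  qed
  also have "\<dots> = (\<Sum>v\<in>A. \<Sum>i\<in>I. of_bool (v \<in> F i))" by (rule sum.swap)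
  also have "\<dots> = (\<Sum>v\<in>A. card {i \<in> I. v \<in> F i})" using assms by (simp add: Int_def)
  finally show ?thesis .
qed

text \<open>A vertex in exactly \<open>k\<close> pieces lies in \<open>k\<close> boundaries if
  \<open>k \<ge> 2\<close> and in none if \<open>k = 1\<close>, in either case in at most
  \<open>2 * (k - 1)\<close>. The excess of the total size over \<open>card A\<close> thus controls
  the boundaries up to a factor 2.\<close>

lemma sum_boundary:
  assumes "finite A" "\<Union>(set Ls) = A"
  shows "(\<Sum>i<length Ls. card (boundary Ls i)) + 2 * card A \<le> 2 * sum_list (map card Ls)"
proof -
  let ?n = "length Ls"
  have sub: "i < ?n \<Longrightarrow> Ls ! i \<subseteq> A" for i using assms by auto
  have "sum_list (map card Ls) = (\<Sum>i<?n. card (Ls ! i))"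
    by (simp add: sum_list_sum_nth atLeast0LessThan)
  also have "\<dots> = (\<Sum>v\<in>A. card {i \<in> {..<?n}. v \<in> Ls ! i})"
    using assms sub by (intro sum_card_swap) auto
  finally have 1: "sum_list (map card Ls) = (\<Sum>v\<in>A. card {i \<in> {..<?n}. v \<in> Ls ! i})" .
  have 2: "(\<Sum>i<?n. card (boundary Ls i)) = (\<Sum>v\<in>A. card {i \<in> {..<?n}. v \<in> boundary Ls i})"
    using assms sub by (intro sum_card_swap) (auto simp: boundary_def)
  have "card {i \<in> {..<?n}. v \<in> boundary Ls i} + 2 \<le> 2 * card {i \<in> {..<?n}. v \<in> Ls ! i}"
    if v: "v \<in> A" for v
  proof -
    define M where "M = {i \<in> {..<?n}. v \<in> Ls ! i}"
    have fM: "finite M" by (simp add: M_def)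
    have "M \<noteq> {}" using v assms by (auto simp: M_def in_set_conv_nth)
    then obtain i where i: "i \<in> M" by blast
    have sub: "{i \<in> {..<?n}. v \<in> boundary Ls i} \<subseteq> M" by (auto simp: M_def boundary_def)
    show ?thesis
    proof (cases "M = {i}")
      case True
      have none: "{i \<in> {..<?n}. v \<in> boundary Ls i} = {}"
      proof (rule ccontr)
        assume "{i \<in> {..<?n}. v \<in> boundary Ls i} \<noteq> {}"
        then obtain k j where "k \<in> M" "j \<in> M" "j \<noteq> k"
          unfolding M_def boundary_def by blast
        then show False using True by simp
      qed
      show ?thesis unfolding none M_def[symmetric] True by simp
    next
      case False
      then have "\<not> M \<subseteq> {i}" using i by blast
      then have "card M \<noteq> 0" "card M \<noteq> 1" using i fM by (auto simp: card_1_singleton_iff)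
      then have "2 \<le> card M" by linarith
      then show ?thesis unfolding M_def[symmetric] using card_mono[OF fM sub] by linarith
    qed
  qed
  then have "(\<Sum>v\<in>A. card {i \<in> {..<?n}. v \<in> boundary Ls i} + 2) \<le> (\<Sum>v\<in>A. 2 * card {i \<in> {..<?n}. v \<in> Ls ! i})"
    by (rule sum_mono)
  then show ?thesis by (simp only: 1 2 sum.distrib sum_distrib_left sum_constant of_nat_id mult.commute)
qed

text \<open>Interiors are disjoint, so the local inequalities add up without counting
  \<open>Opt\<close> twice. The boundaries are paid for twice, by the exchanges and by the part of
  \<open>X\<close> lying on them; with the factor 2 of \<open>sum_boundary\<close> this makes
  4.\<close>

lemma exchange_counting:
  assumes fin: "finite A" and Ls: "\<Union>(set Ls) = A" and X: "X \<subseteq> A" and Opt: "Opt \<subseteq> A"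
    and exch: "\<And>i. i < length Ls \<Longrightarrow>
      card X \<le> card (X - (Ls ! i - boundary Ls i) \<union> (Opt \<inter> Ls ! i) \<union> boundary Ls i)"
  shows "card X + 4 * card A \<le> card Opt + 4 * sum_list (map card Ls)"
proof -
  let ?n = "length Ls"
  define I where "I i = Ls ! i - boundary Ls i" for i
  have sub: "i < ?n \<Longrightarrow> Ls ! i \<subseteq> A" for i using Ls by auto
  have bL: "boundary Ls i \<subseteq> Ls ! i" for i by (auto simp: boundary_def)
  have dis: "I i \<inter> I j = {}" if "i < ?n" "j < ?n" "i \<noteq> j" for i j
    using that by (auto simp: I_def boundary_def)
  have finX: "finite X" "finite Opt" using X Opt fin finite_subset by blast+
  have finL: "finite (Ls ! i)" if "i < ?n" for i using sub[OF that] fin finite_subset by blast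
  have finb: "finite (boundary Ls i)" if "i < ?n" for i using finite_subset[OF bL finL[OF that]] .
  have local: "card (X \<inter> I i) \<le> card (Opt \<inter> I i) + card (boundary Ls i)" if i: "i < ?n" for i
  proof -
    have "X - (Ls ! i - boundary Ls i) \<union> (Opt \<inter> Ls ! i) \<union> boundary Ls i
        = (X - I i) \<union> ((Opt \<inter> I i) \<union> boundary Ls i)" by (auto simp: I_def)
    then have "card X \<le> card ((X - I i) \<union> ((Opt \<inter> I i) \<union> boundary Ls i))"
      using exch[OF i] by simp
    also have "\<dots> \<le> card (X - I i) + (card (Opt \<inter> I i) + card (boundary Ls i))"
      by (meson add_le_mono card_Un_le le_trans order_refl)
    finally show ?thesis using card_Int_Diff[OF finX(1), of "I i"] by linarith
  qed
  have "X \<subseteq> (\<Union>i<?n. X \<inter> I i) \<union> (\<Union>i<?n. boundary Ls i)"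
  proof
    fix v assume v: "v \<in> X"
    then have "v \<in> \<Union>(set Ls)" using X Ls by blast
    then obtain i where "i < ?n" "v \<in> Ls ! i" by (auto simp: in_set_conv_nth)
    then show "v \<in> (\<Union>i<?n. X \<inter> I i) \<union> (\<Union>i<?n. boundary Ls i)" using v by (auto simp: I_def)
  qed
  then have "card X \<le> card ((\<Union>i<?n. X \<inter> I i) \<union> (\<Union>i<?n. boundary Ls i))"
    using finX finb by (intro card_mono) auto
  also have "\<dots> \<le> card (\<Union>i<?n. X \<inter> I i) + card (\<Union>i<?n. boundary Ls i)" by (rule card_Un_le)
  also have "\<dots> \<le> (\<Sum>i<?n. card (X \<inter> I i)) + (\<Sum>i<?n. card (boundary Ls i))"
    by (intro add_mono card_UN_le) auto
  also have "(\<Sum>i<?n. card (X \<inter> I i)) \<le> (\<Sum>i<?n. card (Opt \<inter> I i) + card (boundary Ls i))"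
    by (intro sum_mono) (auto intro: local)
  also have "\<dots> = card (\<Union>i<?n. Opt \<inter> I i) + (\<Sum>i<?n. card (boundary Ls i))"
    using finX dis by (subst card_UN_disjoint) (auto simp: sum.distrib)
  also have "card (\<Union>i<?n. Opt \<inter> I i) \<le> card Opt" using finX by (intro card_mono) auto
  finally have "card X \<le> card Opt + 2 * (\<Sum>i<?n. card (boundary Ls i))" by simp
  then show ?thesis using sum_boundary[OF fin Ls] by linarith
qed

text \<open>A missed \<open>Z\<close> meets \<open>X\<close> only in the interior of the piece and
  contains no boundary vertex of it. Its overlay walk from \<open>X\<close> to \<open>Opt\<close>
  cannot leave the interior, since an overlay edge lies within one piece and an interior vertex
  belongs to no other piece. So the end of the walk in \<open>Opt\<close> lies in the piece, where
  all of \<open>Opt\<close> was added.\<close>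

lemma exchange_hitting:
  assumes div: "division (overlay G A D) A Ls" and A: "A \<subseteq> verts G"
    and X: "hitting_set \<pi> G X" "X \<subseteq> A" and Opt: "hitting_set \<pi> G Opt" "Opt \<subseteq> A"
    and conn: "\<And>Z u v. Z \<subseteq> verts G \<Longrightarrow> \<pi> G Z \<Longrightarrow> u \<in> Z \<Longrightarrow> v \<in> Z \<Longrightarrow> reach (adj G) Z D u v"
    and i: "i < length Ls"
  shows "hitting_set \<pi> G (X - (Ls ! i - boundary Ls i) \<union> (Opt \<inter> Ls ! i) \<union> boundary Ls i)"
    (is "hitting_set \<pi> G ?X'")
  unfolding hitting_set_def
proof (intro conjI allI impI)
  have L: "Ls ! i \<subseteq> A" using div i by (auto simp: division_def)
  then show "?X' \<subseteq> verts G" using X A by (auto simp: boundary_def)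
  fix Z assume "Z \<subseteq> verts G \<and> \<pi> G Z"
  then have Z: "Z \<subseteq> verts G" "\<pi> G Z" by auto
  show "?X' \<inter> Z \<noteq> {}"
  proof
    assume miss: "?X' \<inter> Z = {}"
    obtain x y where x: "x \<in> X" "x \<in> Z" and y: "y \<in> Opt" "y \<in> Z"
      using X(1) Opt(1) Z unfolding hitting_set_def by blast
    have xI: "x \<in> Ls ! i - boundary Ls i" using miss x by blast
    obtain w where w: "(\<lambda>a b. overlay G A D a b \<and> b \<in> Z)\<^sup>*\<^sup>* x w" "y = w \<or> y \<notin> A"
      using overlay_walk[OF conn[OF Z x(2) y(2)] order_refl Z(1), of A] x(1) X(2) by blast
    have "y = w" using w(2) y(1) Opt(2) by blast
    have "w \<in> Ls ! i - boundary Ls i" using w(1)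
    proof (induction rule: rtranclp_induct)
      case base
      show ?case by (rule xI)
    next
      case (step a b)
      then have "a \<in> A" "b \<in> A" "overlay G A D a b" "b \<in> Z" by (auto simp: overlay_def)
      then obtain k where k: "k < length Ls" "a \<in> Ls ! k" "b \<in> Ls ! k"
        using div unfolding division_def by (metis in_set_conv_nth)
      have "k = i" using step.IH k i by (auto simp: boundary_def)
      then show ?case using k \<open>b \<in> Z\<close> miss by blast
    qed
    then show False using y miss \<open>y = w\<close> by blast
  qed
qed

text \<open>The set to flip is \<open>symdiff X X'\<close>; it lies in \<open>L\<close> because the
  two sets agree outside \<open>L\<close>, so its size is at most \<open>c\<close>.\<close>

lemma ls_step_exchange:
  assumes X: "hitting_set \<pi> G X'" and LG: "L \<subseteq> verts G" "finite L" "card L \<le> c"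
    and diff: "X - L = X' - L" and less: "card X' < card X"
  shows "\<exists>X'. ls_step \<pi> c G X X'"
proof -
  let ?Y = "symdiff X X'"
  have "?Y \<subseteq> L" using diff by (auto simp: symdiff_def)
  then have "card ?Y \<le> c" using LG card_mono le_trans by blast
  moreover have "symdiff X ?Y = X'" by (auto simp: symdiff_def)
  ultimately have "ls_step \<pi> c G X X'"
    unfolding ls_step_def using X less \<open>?Y \<subseteq> L\<close> LG by (intro exI[of _ ?Y]) auto
  then show ?thesis by blast
qed

theorem theorem1:
  fixes \<G> :: "'a graph set" and \<pi> :: "'a graph \<Rightarrow> 'a set \<Rightarrow> bool" and \<epsilon> :: real
  assumes "\<forall>G\<in>\<G>. is_graph G"
    and "polynomial_expansion \<G>"
    and "is_property \<pi>"
    and "finite_diameter \<pi>"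
    and "\<epsilon> > 0"
  shows "\<exists>c::nat. c > 0 \<and> (\<forall>G\<in>\<G>. \<forall>X. ls_returns \<pi> c G X \<longrightarrow>
           hitting_set \<pi> G X \<and> real (card X) \<le> (1 + \<epsilon>) * real (gamma \<pi> G))"
proof -
  obtain p :: "real poly" where p: "\<And>r::nat. poly p (real r) \<ge> 0"
    and exp: "\<And>G. G \<in> \<G> \<Longrightarrow> expansion_bounded_by G (\<lambda>r. poly p (real r))"
    using assms(2) unfolding polynomial_expansion_def by blast
  define f where "f = (\<lambda>r::nat. poly p (real r))"
  obtain D where D: "\<And>G Z u v. is_graph G \<Longrightarrow> \<pi> G Z \<Longrightarrow> u \<in> Z \<Longrightarrow> v \<in> Z \<Longrightarrow> reach (adj G) Z D u v"
    using assms(4) unfolding finite_diameter_def walk_within_iff_reach by blast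
  define \<xi> where "\<xi> = nat \<lceil>2 * f D\<rceil> + 1"
  have \<xi>: "2 * f D \<le> real \<xi>" "\<xi> \<ge> 1" using real_nat_ceiling_ge[of "2 * f D"] by (auto simp: \<xi>_def)
  define C where "C = \<xi> * (\<xi> * (D + 1))"
  have C: "C \<ge> 1" using \<xi>(2) by (simp add: C_def)
  define m where "m = 1 + \<xi> * (D + 1)"
  \<comment> \<open>Truncating at 1 gives \<open>e * e \<le> e\<close>, used in the final
    estimate.\<close>
  define e where "e = min 1 \<epsilon>"
  have e: "0 < e" "e \<le> 1" "e \<le> \<epsilon>" using assms(5) by (auto simp: e_def)
  \<comment> \<open>Chosen so that the boundary cost \<open>4 * \<delta> * card A\<close>, with
    \<open>card A \<le> m * (card X + card Opt)\<close>, is at most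
    \<open>e / 4 * (card X + card Opt)\<close>.\<close>
  define \<delta> where "\<delta> = e / (16 * real m)"
  have m: "real m \<ge> 1" by (simp add: m_def)
  have "16 * real m \<ge> 1" using m by linarith
  then have \<delta>: "0 < \<delta>" "\<delta> \<le> 1" using e by (auto simp: \<delta>_def divide_le_eq)
  obtain J0 where J0: "\<And>j. J0 \<le> j \<Longrightarrow>
      real (j\<^sup>2 * (clique_size f C D j * (clique_size f C D j * (2 * ball_radius j + 1)))) \<le> (4/3) ^ j"
    using eventually_clique_size_small[OF p, of C D] unfolding f_def eventually_sequentially by blast
  define J where "J = max J0 (max 5 (nat \<lceil>8 / \<delta>\<rceil>))"
  have J: "8 / \<delta> \<le> real J" "5 \<le> J" "J0 \<le> J"
    using real_nat_ceiling_ge[of "8 / \<delta>"] by (auto simp: J_def)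
  \<comment> \<open>An exchange alters a single piece, so the bound on piece sizes is enough. It
    depends on \<open>p\<close>, \<open>D\<close> and \<open>\<epsilon>\<close>, not on the
    graph.\<close>
  define c where "c = nat \<lceil>(4/3 :: real) ^ J\<rceil>"
  have "hitting_set \<pi> G X \<and> real (card X) \<le> (1 + \<epsilon>) * real (gamma \<pi> G)"
    if GG: "G \<in> \<G>" and ret: "ls_returns \<pi> c G X" for G X
  proof
    have G: "is_graph G" using assms(1) GG by blast
    then have finV: "finite (verts G)" by (simp add: is_graph_def)
    have expG: "expansion_bounded_by G f" using exp[OF GG] by (simp add: f_def)
    \<comment> \<open>The whole vertex set is hitting because every \<open>Z\<close> with the
      property is nonempty.\<close>
    have hV: "hitting_set \<pi> G (verts G)"
      using assms(3) G unfolding is_property_def hitting_set_def by blast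
    have "(ls_step \<pi> c G)\<^sup>*\<^sup>* (verts G) X" using ret by (simp add: ls_returns_def)
    then show hX: "hitting_set \<pi> G X"
      by (induction rule: rtranclp_induct) (auto simp: hV ls_step_def)
    have opt: "\<And>X'. \<not> ls_step \<pi> c G X X'" using ret by (simp add: ls_returns_def)
    have "{card X | X. hitting_set \<pi> G X} \<subseteq> {..card (verts G)}"
      using finV by (auto simp: hitting_set_def intro: card_mono)
    then have "gamma \<pi> G \<in> {card X | X. hitting_set \<pi> G X}"
      unfolding gamma_def using hV by (intro Min_in) (auto intro: finite_subset)
    then obtain Opt where Opt: "hitting_set \<pi> G Opt" "card Opt = gamma \<pi> G" by auto
    have XV: "X \<subseteq> verts G" "Opt \<subseteq> verts G" using hX Opt by (auto simp: hitting_set_def)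
    then obtain A where A: "X \<union> Opt \<subseteq> A" "A \<subseteq> verts G" "card A \<le> m * card (X \<union> Opt)"
      and closed: "\<And>v. v \<in> verts G - A \<Longrightarrow>
        card {w \<in> A. \<exists>u. reach (adj G) (verts G - A) D v u \<and> adj G u w} \<le> C"
      using closure_exists[OF G expG \<xi>, of "X \<union> Opt"] unfolding m_def C_def by auto
    have finA: "finite A" using A finV finite_subset by blast
    obtain Ls where Ls: "division (overlay G A D) A Ls" "\<And>L. L \<in> set Ls \<Longrightarrow> real (card L) \<le> (4/3) ^ J"
        "real (sum_list (map card Ls)) \<le> (1 + \<delta>) * real (card A)"
      using overlay_division[OF G expG _ C A(2) closed \<delta> J(1,2) J0] p J(3) by (auto simp: f_def)
    have LsA: "\<Union>(set Ls) = A" using Ls(1) by (simp add: division_def)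
    have "card X + 4 * card A \<le> card Opt + 4 * sum_list (map card Ls)"
    proof (rule exchange_counting[OF finA LsA])
      show "X \<subseteq> A" "Opt \<subseteq> A" using A by auto
      fix i assume i: "i < length Ls"
      let ?X' = "X - (Ls ! i - boundary Ls i) \<union> (Opt \<inter> Ls ! i) \<union> boundary Ls i"
      have LA: "Ls ! i \<subseteq> A" using LsA i by auto
      show "card X \<le> card ?X'"
      proof (rule ccontr)
        assume "\<not> card X \<le> card ?X'"
        then have less: "card ?X' < card X" by simp
        have hit: "hitting_set \<pi> G ?X'"
          using D[OF G] i A by (intro exchange_hitting[OF Ls(1) A(2) hX _ Opt(1)]) auto
        have "real (card (Ls ! i)) \<le> (4/3) ^ J" using Ls(2) i by simp
        then have "card (Ls ! i) \<le> c" unfolding c_def by linarith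
        then have "\<exists>X''. ls_step \<pi> c G X X''"
          using LA A(2) finA finite_subset less
          by (intro ls_step_exchange[OF hit, of "Ls ! i"]) (auto simp: boundary_def)
        then show False using opt by blast
      qed
    qed
    then have "real (card X) + 4 * real (card A) \<le> real (card Opt) + 4 * ((1 + \<delta>) * real (card A))"
      using Ls(3) by linarith
    then have "real (card X) \<le> real (card Opt) + 4 * \<delta> * real (card A)" by (simp add: algebra_simps)
    also have "\<dots> \<le> real (card Opt) + 4 * \<delta> * (real m * (real (card X) + real (card Opt)))"
    proof -
      have "card A \<le> m * (card X + card Opt)"
        using A(3) card_Un_le[of X Opt] by (meson le_trans mult_le_mono2)
      then have "real (card A) \<le> real (m * (card X + card Opt))" by (rule of_nat_mono)
      then show ?thesis using \<delta> by (intro add_left_mono mult_left_mono) auto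
    qed
    also have "4 * \<delta> * (real m * (real (card X) + real (card Opt))) = e / 4 * (real (card X) + real (card Opt))"
      using m by (simp add: \<delta>_def)
    finally have "(1 - e / 4) * real (card X) \<le> (1 + e / 4) * real (card Opt)"
      by (simp add: algebra_simps)
    also have "\<dots> \<le> (1 - e / 4) * ((1 + e) * real (card Opt))"
    proof -
      have "e * e \<le> e" using mult_left_mono[of e 1 e] e by simp
      moreover have "(1 - e / 4) * (1 + e) = 1 + 3 / 4 * e - e * e / 4" by (simp add: field_simps)
      ultimately have "1 + e / 4 \<le> (1 - e / 4) * (1 + e)" using e by linarith
      then show ?thesis by (simp add: mult_right_mono flip: mult.assoc)
    qed
    finally have "real (card X) \<le> (1 + e) * real (card Opt)" using e by (simp add: mult_le_cancel_left_pos)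
    also have "\<dots> \<le> (1 + \<epsilon>) * real (card Opt)" using e by (intro mult_right_mono) auto
    finally show "real (card X) \<le> (1 + \<epsilon>) * real (gamma \<pi> G)" using Opt(2) by simp
  qed
  moreover have "c > 0"
  proof -
    have "(4/3 :: real) ^ J > 0" by simp
    then show ?thesis by (simp add: c_def)
  qed
  ultimately show ?thesis by blast
qed

end
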